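(* Let $(\mathsf{C},\otimes,I)$ be a $\mathbb{Q}_{\ge 0}$-linear symmetric monoidal category, let $A\in\mathsf{C}$ and let $n\ge 0$. Let $D$ be the diagram consisting of the parallel arrows $\sigma:A^{\otimes n}\to A^{\otimes n}$, one for each $\sigma\in S_n$. Consider: (a) coequalizers $u:A^{\otimes n}\to A_n$ of $D$; (b) pairs $(u:A^{\otimes n}\to A_n,\ v:A_n\to A^{\otimes n})$ such that $u;v=\frac{1}{n!}\sum_{\sigma\in S_n}\sigma$ and $v;u=\mathsf{id}_{A_n}$; (c) equalizers $v:A_n\to A^{\otimes n}$ of $D$. The following assignments are well defined and give bijections between (a) and (b) and between (b) and (c), with $(a\to b)$ and $(b\to a)$ mutually inverse, and $(b\to c)$ and $(c\to b)$ mutually inverse: $(a\to b)$ send $u$ to $(u,v)$, where $v:A_n\to A^{\otimes n}$ is the unique arrow with $u;v=\frac{1}{n!}\sum_{\sigma\in S_n}\sigma$; $(b\to a)$ send $(u,v)$ to $u$; $(b\to c)$ send $(u,v)$ to $v$; $(c\to b)$ send $v$ to $(u,v)$, where $u:A^{\otimes n}\to A_n$ is the unique arrow with $u;v=\frac{1}{n!}\sum_{\sigma\in S_n}\sigma$.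
   Context: Conventions. $f;g$ denotes composition in diagrammatic order (first $f$, then $g$). Symmetric monoidal categories are treated as strict (unitors and associators suppressed). For $\sigma\in S_n$, the same symbol $\sigma:A^{\otimes n}\to A^{\otimes n}$ denotes the natural transformation induced by the symmetry $\gamma$: the adjacent transposition $(a,a+1)$ acts as $\mathsf{id}_{A^{\otimes(a-1)}}\otimes\gamma_{A,A}\otimes\mathsf{id}_{A^{\otimes(n-a-1)}}$, and the product $\sigma;\tau$ acts as the composite. $A^{\otimes 0}=I$; $S_0,S_1$ are trivial groups. A $\mathbb{Q}_{\ge 0}$-linear symmetric monoidal category is a symmetric monoidal category in which every hom-set is a module over the commutative semiring $\mathbb{Q}_{\ge 0}$ (a commutative monoid with an action of $\mathbb{Q}_{\ge 0}$ satisfying the usual module axioms), and both composition and $\otimes$ of morphisms are $\mathbb{Q}_{\ge 0}$-bilinear (in particular preserve $0$ in each variable). A (co)equalizer of $D$ means a (co)limit of $D$: a coequalizer is a map $u$ out of $A^{\otimes n}$ with $\sigma;u=\tau;u$ for all $\sigma,\tau\in S_n$, universal among such maps; dually, an equalizer is a map $v$ into $A^{\otimes n}$ with $v;\sigma=v;\tau$ for all $\sigma,\tau\in S_n$, universal among such maps. The object $A_n$ is part of the data in (a), (b), (c) and is kept unchanged by all the assignments. *)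

theory Defs
  imports Complex_Main "HOL-Algebra.FiniteProduct" "HOL-Combinatorics.Permutations"
begin

text \<open>
  Composition is written in diagrammatic order: \<open>f \<Zcomp> g\<close> is first \<open>f\<close>, then \<open>g\<close>.
  Arrows know their domain and codomain, so distinct hom-sets are disjoint.
  Operations are unconstrained outside their intended domains.
\<close>

record ('o, 'm) smc_data =
  Obj :: "'o set"
  Arr :: "'m set"
  Dom :: "'m \<Rightarrow> 'o"
  Cod :: "'m \<Rightarrow> 'o"
  Id :: "'o \<Rightarrow> 'm"
  Comp :: "'m \<Rightarrow> 'm \<Rightarrow> 'm"  (infixl "\<Zcomp>\<index>" 65)
  Unit :: "'o"
  TensorO :: "'o \<Rightarrow> 'o \<Rightarrow> 'o"  (infixl "\<otimes>\<^sub>o\<index>" 75)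
  Tensor :: "'m \<Rightarrow> 'm \<Rightarrow> 'm"  (infixl "\<otimes>\<^sub>m\<index>" 75)
  Assoc :: "'o \<Rightarrow> 'o \<Rightarrow> 'o \<Rightarrow> 'm"
  LUnit :: "'o \<Rightarrow> 'm"
  RUnit :: "'o \<Rightarrow> 'm"
  Sym :: "'o \<Rightarrow> 'o \<Rightarrow> 'm"

definition Hom :: "('o, 'm, 'z) smc_data_scheme \<Rightarrow> 'o \<Rightarrow> 'o \<Rightarrow> 'm set" where
  "Hom C X Y = {f \<in> Arr C. Dom C f = X \<and> Cod C f = Y}"

definition inverse_arrows :: "('o, 'm, 'z) smc_data_scheme \<Rightarrow> 'm \<Rightarrow> 'm \<Rightarrow> bool" where
  "inverse_arrows C f g \<longleftrightarrow>
     f \<in> Arr C \<and> g \<in> Hom C (Cod C f) (Dom C f) \<and>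
     f \<Zcomp>\<^bsub>C\<^esub> g = Id C (Dom C f) \<and> g \<Zcomp>\<^bsub>C\<^esub> f = Id C (Cod C f)"

definition iso_arrow :: "('o, 'm, 'z) smc_data_scheme \<Rightarrow> 'm \<Rightarrow> bool" where
  "iso_arrow C f \<longleftrightarrow> (\<exists>g. inverse_arrows C f g)"

definition inv_arrow :: "('o, 'm, 'z) smc_data_scheme \<Rightarrow> 'm \<Rightarrow> 'm" where
  "inv_arrow C f = (THE g. inverse_arrows C f g)"

locale category =
  fixes C :: "('o, 'm, 'z) smc_data_scheme" (structure)
  assumes Dom_Obj: "f \<in> Arr C \<Longrightarrow> Dom C f \<in> Obj C"
    and Cod_Obj: "f \<in> Arr C \<Longrightarrow> Cod C f \<in> Obj C"
    and Id_Hom: "X \<in> Obj C \<Longrightarrow> Id C X \<in> Hom C X X"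
    and Comp_Hom: "\<lbrakk>f \<in> Hom C X Y; g \<in> Hom C Y Z\<rbrakk> \<Longrightarrow> f \<Zcomp> g \<in> Hom C X Z"
    and Id_Comp: "f \<in> Hom C X Y \<Longrightarrow> Id C X \<Zcomp> f = f"
    and Comp_Id: "f \<in> Hom C X Y \<Longrightarrow> f \<Zcomp> Id C Y = f"
    and Comp_assoc: "\<lbrakk>f \<in> Hom C W X; g \<in> Hom C X Y; h \<in> Hom C Y Z\<rbrakk>
          \<Longrightarrow> (f \<Zcomp> g) \<Zcomp> h = f \<Zcomp> (g \<Zcomp> h)"

locale monoidal_category = category +
  assumes Unit_Obj: "Unit C \<in> Obj C"
    and TensorO_Obj: "\<lbrakk>X \<in> Obj C; Y \<in> Obj C\<rbrakk> \<Longrightarrow> X \<otimes>\<^sub>o Y \<in> Obj C"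
    and Tensor_Hom: "\<lbrakk>f \<in> Hom C X X'; g \<in> Hom C Y Y'\<rbrakk>
          \<Longrightarrow> f \<otimes>\<^sub>m g \<in> Hom C (X \<otimes>\<^sub>o Y) (X' \<otimes>\<^sub>o Y')"
    and Tensor_Id: "\<lbrakk>X \<in> Obj C; Y \<in> Obj C\<rbrakk> \<Longrightarrow> Id C X \<otimes>\<^sub>m Id C Y = Id C (X \<otimes>\<^sub>o Y)"
    and interchange: "\<lbrakk>f \<in> Hom C X X'; f' \<in> Hom C X' X''; g \<in> Hom C Y Y'; g' \<in> Hom C Y' Y''\<rbrakk>
          \<Longrightarrow> (f \<Zcomp> f') \<otimes>\<^sub>m (g \<Zcomp> g') = f \<otimes>\<^sub>m g \<Zcomp> f' \<otimes>\<^sub>m g'"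
    and Assoc_Hom: "\<lbrakk>X \<in> Obj C; Y \<in> Obj C; Z \<in> Obj C\<rbrakk>
          \<Longrightarrow> Assoc C X Y Z \<in> Hom C ((X \<otimes>\<^sub>o Y) \<otimes>\<^sub>o Z) (X \<otimes>\<^sub>o (Y \<otimes>\<^sub>o Z))"
    and Assoc_iso: "\<lbrakk>X \<in> Obj C; Y \<in> Obj C; Z \<in> Obj C\<rbrakk> \<Longrightarrow> iso_arrow C (Assoc C X Y Z)"
    and Assoc_natural: "\<lbrakk>f \<in> Hom C X X'; g \<in> Hom C Y Y'; h \<in> Hom C Z Z'\<rbrakk>
          \<Longrightarrow> (f \<otimes>\<^sub>m g) \<otimes>\<^sub>m h \<Zcomp> Assoc C X' Y' Z' = Assoc C X Y Z \<Zcomp> f \<otimes>\<^sub>m (g \<otimes>\<^sub>m h)"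
    and LUnit_Hom: "X \<in> Obj C \<Longrightarrow> LUnit C X \<in> Hom C (Unit C \<otimes>\<^sub>o X) X"
    and LUnit_iso: "X \<in> Obj C \<Longrightarrow> iso_arrow C (LUnit C X)"
    and LUnit_natural: "f \<in> Hom C X Y \<Longrightarrow> Id C (Unit C) \<otimes>\<^sub>m f \<Zcomp> LUnit C Y = LUnit C X \<Zcomp> f"
    and RUnit_Hom: "X \<in> Obj C \<Longrightarrow> RUnit C X \<in> Hom C (X \<otimes>\<^sub>o Unit C) X"
    and RUnit_iso: "X \<in> Obj C \<Longrightarrow> iso_arrow C (RUnit C X)"
    and RUnit_natural: "f \<in> Hom C X Y \<Longrightarrow> f \<otimes>\<^sub>m Id C (Unit C) \<Zcomp> RUnit C Y = RUnit C X \<Zcomp> f"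
    and triangle: "\<lbrakk>X \<in> Obj C; Y \<in> Obj C\<rbrakk>
          \<Longrightarrow> Assoc C X (Unit C) Y \<Zcomp> Id C X \<otimes>\<^sub>m LUnit C Y = RUnit C X \<otimes>\<^sub>m Id C Y"
    and pentagon: "\<lbrakk>W \<in> Obj C; X \<in> Obj C; Y \<in> Obj C; Z \<in> Obj C\<rbrakk>
          \<Longrightarrow> Assoc C (W \<otimes>\<^sub>o X) Y Z \<Zcomp> Assoc C W X (Y \<otimes>\<^sub>o Z) =
              Assoc C W X Y \<otimes>\<^sub>m Id C Z \<Zcomp> Assoc C W (X \<otimes>\<^sub>o Y) Z \<Zcomp> Id C W \<otimes>\<^sub>m Assoc C X Y Z"

locale symmetric_monoidal_category = monoidal_category +
  assumes Sym_Hom: "\<lbrakk>X \<in> Obj C; Y \<in> Obj C\<rbrakk> \<Longrightarrow> Sym C X Y \<in> Hom C (X \<otimes>\<^sub>o Y) (Y \<otimes>\<^sub>o X)"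
    and Sym_natural: "\<lbrakk>f \<in> Hom C X X'; g \<in> Hom C Y Y'\<rbrakk>
          \<Longrightarrow> f \<otimes>\<^sub>m g \<Zcomp> Sym C X' Y' = Sym C X Y \<Zcomp> g \<otimes>\<^sub>m f"
    and Sym_Sym: "\<lbrakk>X \<in> Obj C; Y \<in> Obj C\<rbrakk> \<Longrightarrow> Sym C X Y \<Zcomp> Sym C Y X = Id C (X \<otimes>\<^sub>o Y)"
    and hexagon: "\<lbrakk>X \<in> Obj C; Y \<in> Obj C; Z \<in> Obj C\<rbrakk>
          \<Longrightarrow> Assoc C X Y Z \<Zcomp> Sym C X (Y \<otimes>\<^sub>o Z) \<Zcomp> Assoc C Y Z X =
              Sym C X Y \<otimes>\<^sub>m Id C Z \<Zcomp> Assoc C Y X Z \<Zcomp> Id C Y \<otimes>\<^sub>m Sym C X Z"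


record ('o, 'm) linear_smc_data = "('o, 'm) smc_data" +
  Zero :: "'o \<Rightarrow> 'o \<Rightarrow> 'm"
  Plus :: "'m \<Rightarrow> 'm \<Rightarrow> 'm"  (infixl "\<oplus>\<^sub>m\<index>" 60)
  Scale :: "rat \<Rightarrow> 'm \<Rightarrow> 'm"  (infixr "\<cdot>\<^sub>m\<index>" 80)

text \<open>The additive monoid of a hom-set, so that \<^const>\<open>finprod\<close> over it is a finite sum of arrows.\<close>

definition hom_monoid :: "('o, 'm, 'z) linear_smc_data_scheme \<Rightarrow> 'o \<Rightarrow> 'o \<Rightarrow> 'm monoid" where
  "hom_monoid C X Y = \<lparr>carrier = Hom C X Y, monoid.mult = Plus C, one = Zero C X Y\<rparr>"

text \<open>The semiring of scalars is \<open>{q :: rat. 0 \<le> q}\<close>; nothing is assumed about other scalars.\<close>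

locale nonneg_rat_linear_smc = symmetric_monoidal_category C
  for C :: "('o, 'm, 'z) linear_smc_data_scheme" (structure) +
  assumes hom_comm_monoid: "\<lbrakk>X \<in> Obj C; Y \<in> Obj C\<rbrakk> \<Longrightarrow> comm_monoid (hom_monoid C X Y)"
    and Scale_Hom: "\<lbrakk>0 \<le> q; f \<in> Hom C X Y\<rbrakk> \<Longrightarrow> q \<cdot>\<^sub>m f \<in> Hom C X Y"
    and Scale_Plus: "\<lbrakk>0 \<le> q; f \<in> Hom C X Y; g \<in> Hom C X Y\<rbrakk>
          \<Longrightarrow> q \<cdot>\<^sub>m (f \<oplus>\<^sub>m g) = q \<cdot>\<^sub>m f \<oplus>\<^sub>m q \<cdot>\<^sub>m g"
    and Scale_zero_right: "\<lbrakk>0 \<le> q; X \<in> Obj C; Y \<in> Obj C\<rbrakk>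
          \<Longrightarrow> q \<cdot>\<^sub>m Zero C X Y = Zero C X Y"
    and plus_Scale: "\<lbrakk>0 \<le> p; 0 \<le> q; f \<in> Hom C X Y\<rbrakk> \<Longrightarrow> (p + q) \<cdot>\<^sub>m f = p \<cdot>\<^sub>m f \<oplus>\<^sub>m q \<cdot>\<^sub>m f"
    and zero_Scale: "f \<in> Hom C X Y \<Longrightarrow> 0 \<cdot>\<^sub>m f = Zero C X Y"
    and mult_Scale: "\<lbrakk>0 \<le> p; 0 \<le> q; f \<in> Hom C X Y\<rbrakk> \<Longrightarrow> (p * q) \<cdot>\<^sub>m f = p \<cdot>\<^sub>m (q \<cdot>\<^sub>m f)"
    and one_Scale: "f \<in> Hom C X Y \<Longrightarrow> 1 \<cdot>\<^sub>m f = f"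
    and Comp_Plus_left: "\<lbrakk>f \<in> Hom C X Y; g \<in> Hom C X Y; h \<in> Hom C Y Z\<rbrakk>
          \<Longrightarrow> (f \<oplus>\<^sub>m g) \<Zcomp> h = (f \<Zcomp> h) \<oplus>\<^sub>m (g \<Zcomp> h)"
    and Comp_Plus_right: "\<lbrakk>f \<in> Hom C X Y; g \<in> Hom C Y Z; h \<in> Hom C Y Z\<rbrakk>
          \<Longrightarrow> f \<Zcomp> (g \<oplus>\<^sub>m h) = (f \<Zcomp> g) \<oplus>\<^sub>m (f \<Zcomp> h)"
    and Comp_Zero_left: "\<lbrakk>X \<in> Obj C; f \<in> Hom C Y Z\<rbrakk> \<Longrightarrow> Zero C X Y \<Zcomp> f = Zero C X Z"
    and Comp_Zero_right: "\<lbrakk>f \<in> Hom C X Y; Z \<in> Obj C\<rbrakk> \<Longrightarrow> f \<Zcomp> Zero C Y Z = Zero C X Z"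
    and Comp_Scale_left: "\<lbrakk>0 \<le> q; f \<in> Hom C X Y; g \<in> Hom C Y Z\<rbrakk>
          \<Longrightarrow> (q \<cdot>\<^sub>m f) \<Zcomp> g = q \<cdot>\<^sub>m (f \<Zcomp> g)"
    and Comp_Scale_right: "\<lbrakk>0 \<le> q; f \<in> Hom C X Y; g \<in> Hom C Y Z\<rbrakk>
          \<Longrightarrow> f \<Zcomp> (q \<cdot>\<^sub>m g) = q \<cdot>\<^sub>m (f \<Zcomp> g)"
    and Tensor_Plus_left: "\<lbrakk>f \<in> Hom C X X'; g \<in> Hom C X X'; h \<in> Hom C Y Y'\<rbrakk>
          \<Longrightarrow> (f \<oplus>\<^sub>m g) \<otimes>\<^sub>m h = (f \<otimes>\<^sub>m h) \<oplus>\<^sub>m (g \<otimes>\<^sub>m h)"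
    and Tensor_Plus_right: "\<lbrakk>f \<in> Hom C X X'; g \<in> Hom C Y Y'; h \<in> Hom C Y Y'\<rbrakk>
          \<Longrightarrow> f \<otimes>\<^sub>m (g \<oplus>\<^sub>m h) = (f \<otimes>\<^sub>m g) \<oplus>\<^sub>m (f \<otimes>\<^sub>m h)"
    and Tensor_Zero_left: "\<lbrakk>X \<in> Obj C; X' \<in> Obj C; f \<in> Hom C Y Y'\<rbrakk>
          \<Longrightarrow> Zero C X X' \<otimes>\<^sub>m f = Zero C (X \<otimes>\<^sub>o Y) (X' \<otimes>\<^sub>o Y')"
    and Tensor_Zero_right: "\<lbrakk>f \<in> Hom C X X'; Y \<in> Obj C; Y' \<in> Obj C\<rbrakk>
          \<Longrightarrow> f \<otimes>\<^sub>m Zero C Y Y' = Zero C (X \<otimes>\<^sub>o Y) (X' \<otimes>\<^sub>o Y')"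
    and Tensor_Scale_left: "\<lbrakk>0 \<le> q; f \<in> Hom C X X'; g \<in> Hom C Y Y'\<rbrakk>
          \<Longrightarrow> (q \<cdot>\<^sub>m f) \<otimes>\<^sub>m g = q \<cdot>\<^sub>m (f \<otimes>\<^sub>m g)"
    and Tensor_Scale_right: "\<lbrakk>0 \<le> q; f \<in> Hom C X X'; g \<in> Hom C Y Y'\<rbrakk>
          \<Longrightarrow> f \<otimes>\<^sub>m (q \<cdot>\<^sub>m g) = q \<cdot>\<^sub>m (f \<otimes>\<^sub>m g)"


primrec tensor_pow :: "('o, 'm, 'z) smc_data_scheme \<Rightarrow> 'o \<Rightarrow> nat \<Rightarrow> 'o" where
  "tensor_pow C A 0 = Unit C"
| "tensor_pow C A (Suc n) = tensor_pow C A n \<otimes>\<^sub>o\<^bsub>C\<^esub> A"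

primrec tensor_id_pow :: "('o, 'm, 'z) smc_data_scheme \<Rightarrow> 'o \<Rightarrow> 'm \<Rightarrow> nat \<Rightarrow> 'm" where
  "tensor_id_pow C A f 0 = f"
| "tensor_id_pow C A f (Suc k) = tensor_id_pow C A f k \<otimes>\<^sub>m\<^bsub>C\<^esub> Id C A"

text \<open>
  Tensor factors are numbered \<open>0, \<dots>, n - 1\<close> and tensor powers are bracketed to the left.
  The next arrow exchanges the factors \<open>a\<close> and \<open>a + 1\<close>, where \<open>a + 1 < n\<close>. With associators
  suppressed it is the tensor product of the identity of \<open>A\<close> to the power \<open>a\<close>, of the symmetry
  of \<open>A\<close> with itself, and of the identity of \<open>A\<close> to the power \<open>n - a - 2\<close>.
\<close>

definition adjacent_arrow :: "('o, 'm, 'z) smc_data_scheme \<Rightarrow> 'o \<Rightarrow> nat \<Rightarrow> nat \<Rightarrow> 'm" where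
  "adjacent_arrow C A n a =
     (let P = tensor_pow C A a in
      tensor_id_pow C A
        (Assoc C P A A \<Zcomp>\<^bsub>C\<^esub> Id C P \<otimes>\<^sub>m\<^bsub>C\<^esub> Sym C A A \<Zcomp>\<^bsub>C\<^esub> inv_arrow C (Assoc C P A A))
        (n - a - 2))"

text \<open>
  The graph of the action of the permutations of \<open>{..<n}\<close>. The product of permutations is in
  diagrammatic order too: \<open>\<tau> \<circ> \<sigma>\<close> is first \<open>\<sigma>\<close>, then \<open>\<tau>\<close>.
\<close>

inductive perm_acts :: "('o, 'm, 'z) smc_data_scheme \<Rightarrow> 'o \<Rightarrow> nat \<Rightarrow> (nat \<Rightarrow> nat) \<Rightarrow> 'm \<Rightarrow> bool"
  for C A n where
  ident: "perm_acts C A n id (Id C (tensor_pow C A n))"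
| adjacent: "Suc a < n \<Longrightarrow> perm_acts C A n (transpose a (Suc a)) (adjacent_arrow C A n a)"
| product: "\<lbrakk>perm_acts C A n \<sigma> f; perm_acts C A n \<tau> g\<rbrakk> \<Longrightarrow> perm_acts C A n (\<tau> \<circ> \<sigma>) (f \<Zcomp>\<^bsub>C\<^esub> g)"

definition perm_arrow :: "('o, 'm, 'z) smc_data_scheme \<Rightarrow> 'o \<Rightarrow> nat \<Rightarrow> (nat \<Rightarrow> nat) \<Rightarrow> 'm" where
  "perm_arrow C A n \<sigma> = (THE f. perm_acts C A n \<sigma> f)"

definition perm_diagram :: "('o, 'm, 'z) smc_data_scheme \<Rightarrow> 'o \<Rightarrow> nat \<Rightarrow> 'm set" where
  "perm_diagram C A n = perm_arrow C A n ` {\<sigma>. \<sigma> permutes {..<n}}"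

definition symmetrizer :: "('o, 'm, 'z) linear_smc_data_scheme \<Rightarrow> 'o \<Rightarrow> nat \<Rightarrow> 'm" where
  "symmetrizer C A n =
     (let P = tensor_pow C A n in
      (1 / fact n) \<cdot>\<^sub>m\<^bsub>C\<^esub> finprod (hom_monoid C P P) (perm_arrow C A n) {\<sigma>. \<sigma> permutes {..<n}})"


text \<open>Here \<open>F\<close> is a set of parallel arrows with common codomain (resp. domain) \<open>P\<close>.\<close>

definition is_coequalizer ::
  "('o, 'm, 'z) smc_data_scheme \<Rightarrow> 'm set \<Rightarrow> 'o \<Rightarrow> 'o \<Rightarrow> 'm \<Rightarrow> bool" where
  "is_coequalizer C F P Q u \<longleftrightarrow>
     Q \<in> Obj C \<and> u \<in> Hom C P Q \<and> (\<forall>f\<in>F. \<forall>g\<in>F. f \<Zcomp>\<^bsub>C\<^esub> u = g \<Zcomp>\<^bsub>C\<^esub> u) \<and>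
     (\<forall>Z\<in>Obj C. \<forall>w\<in>Hom C P Z. (\<forall>f\<in>F. \<forall>g\<in>F. f \<Zcomp>\<^bsub>C\<^esub> w = g \<Zcomp>\<^bsub>C\<^esub> w) \<longrightarrow>
        (\<exists>!t. t \<in> Hom C Q Z \<and> u \<Zcomp>\<^bsub>C\<^esub> t = w))"

definition is_equalizer ::
  "('o, 'm, 'z) smc_data_scheme \<Rightarrow> 'm set \<Rightarrow> 'o \<Rightarrow> 'o \<Rightarrow> 'm \<Rightarrow> bool" where
  "is_equalizer C F P Q v \<longleftrightarrow>
     Q \<in> Obj C \<and> v \<in> Hom C Q P \<and> (\<forall>f\<in>F. \<forall>g\<in>F. v \<Zcomp>\<^bsub>C\<^esub> f = v \<Zcomp>\<^bsub>C\<^esub> g) \<and>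
     (\<forall>Z\<in>Obj C. \<forall>w\<in>Hom C Z P. (\<forall>f\<in>F. \<forall>g\<in>F. w \<Zcomp>\<^bsub>C\<^esub> f = w \<Zcomp>\<^bsub>C\<^esub> g) \<longrightarrow>
        (\<exists>!t. t \<in> Hom C Z Q \<and> t \<Zcomp>\<^bsub>C\<^esub> v = w))"

definition sym_coequalizers ::
  "('o, 'm, 'z) smc_data_scheme \<Rightarrow> 'o \<Rightarrow> nat \<Rightarrow> ('o \<times> 'm) set" where
  "sym_coequalizers C A n = {(Q, u). is_coequalizer C (perm_diagram C A n) (tensor_pow C A n) Q u}"

definition sym_splittings ::
  "('o, 'm, 'z) linear_smc_data_scheme \<Rightarrow> 'o \<Rightarrow> nat \<Rightarrow> ('o \<times> 'm \<times> 'm) set" where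
  "sym_splittings C A n =
     {(Q, u, v). Q \<in> Obj C \<and> u \<in> Hom C (tensor_pow C A n) Q \<and> v \<in> Hom C Q (tensor_pow C A n) \<and>
        u \<Zcomp>\<^bsub>C\<^esub> v = symmetrizer C A n \<and> v \<Zcomp>\<^bsub>C\<^esub> u = Id C Q}"

definition sym_equalizers ::
  "('o, 'm, 'z) smc_data_scheme \<Rightarrow> 'o \<Rightarrow> nat \<Rightarrow> ('o \<times> 'm) set" where
  "sym_equalizers C A n = {(Q, v). is_equalizer C (perm_diagram C A n) (tensor_pow C A n) Q v}"

definition coequalizer_to_splitting ::
  "('o, 'm, 'z) linear_smc_data_scheme \<Rightarrow> 'o \<Rightarrow> nat \<Rightarrow> 'o \<times> 'm \<Rightarrow> 'o \<times> 'm \<times> 'm" where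
  "coequalizer_to_splitting C A n = (\<lambda>(Q, u).
     (Q, u, THE v. v \<in> Hom C Q (tensor_pow C A n) \<and> u \<Zcomp>\<^bsub>C\<^esub> v = symmetrizer C A n))"

definition splitting_to_coequalizer :: "'o \<times> 'm \<times> 'm \<Rightarrow> 'o \<times> 'm" where
  "splitting_to_coequalizer = (\<lambda>(Q, u, v). (Q, u))"

definition splitting_to_equalizer :: "'o \<times> 'm \<times> 'm \<Rightarrow> 'o \<times> 'm" where
  "splitting_to_equalizer = (\<lambda>(Q, u, v). (Q, v))"

definition equalizer_to_splitting ::
  "('o, 'm, 'z) linear_smc_data_scheme \<Rightarrow> 'o \<Rightarrow> nat \<Rightarrow> 'o \<times> 'm \<Rightarrow> 'o \<times> 'm \<times> 'm" where
  "equalizer_to_splitting C A n = (\<lambda>(Q, v).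
     (Q, (THE u. u \<in> Hom C (tensor_pow C A n) Q \<and> u \<Zcomp>\<^bsub>C\<^esub> v = symmetrizer C A n), v))"

end

theory Submission
  imports Defs
begin

text \<open>
  Write \<open>P\<close> for the tensor power and \<open>e\<close> for the symmetrizer. Since \<open>\<sigma>; e = e = e; \<sigma>\<close>, and since
  \<open>e; w = w\<close> for every \<open>w\<close> out of \<open>P\<close> that coequalizes the permutations, a coequalizer \<open>u\<close> factors
  \<open>e\<close> as \<open>u; v\<close>, and \<open>u; (v; u) = e; u = u\<close> forces \<open>v; u = id\<close>. Conversely, if \<open>u\<close> and \<open>v\<close> split
  \<open>e\<close>, then \<open>w = e; w = u; (v; w)\<close>, so \<open>u\<close> is a coequalizer. Equalizers are the same statement in
  the opposite category.

  That every permutation acts by a single arrow rests on the Coxeter relations between the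
  adjacent symmetries. They suffice because each word in the generators \<open>s\<^sub>0, \<dots>, s\<^sub>m\<close> can be
  rewritten as a word in \<open>s\<^sub>0, \<dots>, s\<^bsub>m-1\<^esub>\<close> followed by a descending run \<open>s\<^sub>m \<dots> s\<^sub>k\<close>, where \<open>k\<close> is
  determined by the permutation as the image of \<open>m + 1\<close>.
\<close>

section \<open>Monoids satisfying the Coxeter relations of type A\<close>

text \<open>Here \<open>n\<close> counts strands, so the generators are \<open>s 0\<close>, ...,
  \<open>s (n - 2)\<close>. The monoid may satisfy further relations: it is only the target of an
  action, not a presentation.\<close>

locale coxeter_monoid = monoid G for G (structure) +
  fixes s :: "nat \<Rightarrow> 'a" and n :: nat
  assumes gen_closed: "Suc a < n \<Longrightarrow> s a \<in> carrier G"
    and gen_square: "Suc a < n \<Longrightarrow> s a \<otimes> s a = \<one>"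
    and gen_commute: "\<lbrakk>Suc a < b; Suc b < n\<rbrakk> \<Longrightarrow> s a \<otimes> s b = s b \<otimes> s a"
    and gen_braid: "Suc (Suc a) < n \<Longrightarrow> s a \<otimes> s (Suc a) \<otimes> s a = s (Suc a) \<otimes> s a \<otimes> s (Suc a)"
begin

text \<open>The descending run s_(m-1) ... s_k, empty for k >= m. For k = 0, ..., m these runs model
  the coset representatives of the symmetric group on m letters in that on m + 1 letters.\<close>

primrec descent :: "nat \<Rightarrow> nat \<Rightarrow> 'a" where
  "descent k 0 = \<one>"
| "descent k (Suc m) = (if k \<le> m then s m \<otimes> descent k m else \<one>)"

text \<open>Words in the first \<open>m\<close> generators. They grow on the right, where the run of
  a normal form has to absorb the new letter.\<close>

inductive_set generated :: "nat \<Rightarrow> 'a set" for m where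
  one: "\<one> \<in> generated m"
| snoc: "\<lbrakk>x \<in> generated m; a < m\<rbrakk> \<Longrightarrow> x \<otimes> s a \<in> generated m"

section \<open>Moving a letter through a descending run\<close>

lemma descent_closed: "m < n \<Longrightarrow> descent k m \<in> carrier G"
  by (induction m) (auto simp: gen_closed)

lemma generated_closed: "\<lbrakk>x \<in> generated m; m < n\<rbrakk> \<Longrightarrow> x \<in> carrier G"
  by (induction rule: generated.induct) (auto simp: gen_closed)

lemma generated_mult:
  assumes "y \<in> generated m" "x \<in> generated m" "m < n"
  shows "x \<otimes> y \<in> generated m"
  using assms
proof (induction rule: generated.induct)
  case one
  then show ?case by (simp add: generated_closed)
next
  case (snoc y a)
  then show ?case
    by (simp add: generated_closed gen_closed generated.snoc flip: m_assoc)
qed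

lemma generated_gen: "\<lbrakk>a < m; m < n\<rbrakk> \<Longrightarrow> s a \<in> generated m"
  using generated.snoc[OF generated.one, of a m] by (simp add: gen_closed)

lemma descent_self [simp]: "descent m m = \<one>"
  by (cases m) auto

text \<open>The recursion exposes the first letter of a run; extending or shortening a run at its
  low end needs the last one.\<close>

lemma descent_Suc: "\<lbrakk>k < m; m < n\<rbrakk> \<Longrightarrow> descent k m = descent (Suc k) m \<otimes> s k"
proof (induction m)
  case (Suc m)
  show ?case
  proof (cases "k = m")
    case True
    then show ?thesis using Suc.prems by (simp add: gen_closed)
  next
    case False
    then show ?thesis using Suc by (simp add: gen_closed descent_closed m_assoc)
  qed
qed simp

text \<open>All letters of the run have index at least \<open>k\<close>, hence differ from
  \<open>a\<close> by at least two and commute with \<open>s a\<close>.\<close>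

lemma descent_gen_below:
  assumes "Suc a < k" "Suc a < n" "m < n"
  shows "descent k m \<otimes> s a = s a \<otimes> descent k m"
  using assms(3)
proof (induction m)
  case 0
  then show ?case using assms by (simp add: gen_closed)
next
  case (Suc m)
  show ?case
  proof (cases "k \<le> m")
    case True
    have "descent k (Suc m) \<otimes> s a = s m \<otimes> (s a \<otimes> descent k m)"
      using True Suc assms by (simp add: gen_closed descent_closed m_assoc)
    also have "\<dots> = s a \<otimes> s m \<otimes> descent k m"
      using True Suc.prems assms gen_commute[of a m]
      by (simp add: gen_closed descent_closed flip: m_assoc)
    finally show ?thesis
      using True Suc.prems assms by (simp add: gen_closed descent_closed m_assoc)
  next
    case False
    then show ?thesis using assms by (simp add: gen_closed)
  qed
qed

text \<open>The run contains s_(a+1) s_a. The new letter s_(a+1) passes the letters below s_a, the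
  braid relation turns s_(a+1) s_a s_(a+1) into s_a s_(a+1) s_a, and the leading s_a passes the
  letters above s_(a+1). Hence the index drops by one.\<close>

lemma descent_gen_above:
  assumes "k \<le> a" "Suc a < m" "m < n"
  shows "descent k m \<otimes> s (Suc a) = s a \<otimes> descent k m"
  using assms(2,3)
proof (induction m)
  case (Suc m)
  note closed = gen_closed descent_closed
  show ?case
  proof (cases "Suc a = m")
    \<comment> \<open>The run begins with \<open>s (Suc a)\<close>, so the braid relation acts at
      its very front.\<close>
    case True
    have "descent k (Suc m) \<otimes> s m = s (Suc a) \<otimes> (s a \<otimes> (descent k a \<otimes> s (Suc a)))"
      using assms True Suc.prems by (auto simp: closed m_assoc)
    also have "\<dots> = s (Suc a) \<otimes> s a \<otimes> s (Suc a) \<otimes> descent k a"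
    proof -
      \<comment> \<open>For \<open>b\<close> at most \<open>a\<close>, the letters of this run have
        index below \<open>a\<close> and commute with \<open>s (Suc a)\<close>.\<close>
      have "descent k' b \<otimes> s (Suc a) = s (Suc a) \<otimes> descent k' b" if "b \<le> a" for b k'
        using that
      proof (induction b)
        case 0
        then show ?case using Suc.prems by (simp add: closed)
      next
        case (Suc b)
        then show ?case
          using \<open>Suc m < n\<close> True gen_commute[of b "Suc a"]
          by (auto simp: closed m_assoc) (simp add: closed flip: m_assoc)
      qed
      then show ?thesis
        using True Suc.prems by (simp add: closed m_assoc)
    qed
    also have "\<dots> = s a \<otimes> s (Suc a) \<otimes> s a \<otimes> descent k a"
      using True Suc.prems gen_braid[of a] by simp
    finally show ?thesis
      using assms True Suc.prems by (auto simp: closed m_assoc)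
  next
    case False
    have "descent k (Suc m) \<otimes> s (Suc a) = s m \<otimes> (s a \<otimes> descent k m)"
      using False Suc assms by (simp add: closed m_assoc)
    also have "\<dots> = s a \<otimes> s m \<otimes> descent k m"
      using False Suc.prems gen_commute[of a m] by (simp add: closed flip: m_assoc)
    finally show ?thesis
      using False Suc.prems assms by (simp add: closed m_assoc)
  qed
qed simp

text \<open>Appending \<open>s a\<close> to a run that ends in \<open>s k\<close> has four outcomes:
  for a < k - 1 the letter passes to the left; for a = k - 1 it extends the run; for a = k it
  cancels the last letter; for a > k it passes to the left with index a - 1. A letter that leaves
  the run always has index below \<open>m\<close>, so it joins \<open>y\<close>.\<close>

lemma generated_Suc_normal_form:
  assumes "x \<in> generated (Suc m)" "Suc m < n"
  shows "\<exists>y \<in> generated m. \<exists>k \<le> Suc m. x = y \<otimes> descent k (Suc m)"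
  using assms
proof (induction rule: generated.induct)
  case one
  have "\<one> = \<one> \<otimes> descent (Suc m) (Suc m)" by simp
  then show ?case using generated.one by blast
next
  case (snoc x a)
  then obtain y k where y: "y \<in> generated m" and k: "k \<le> Suc m"
    and x: "x = y \<otimes> descent k (Suc m)" by blast
  let ?c = "\<lambda>k. descent k (Suc m)"
  have [simp]: "y \<in> carrier G" "s a \<in> carrier G" "?c k \<in> carrier G" for k
    using y snoc.hyps snoc.prems by (simp_all add: generated_closed gen_closed descent_closed
        del: descent.simps)
  have xa: "x \<otimes> s a = y \<otimes> (?c k \<otimes> s a)"
    by (simp add: x m_assoc del: descent.simps)
  consider "Suc a < k" | "Suc a = k" | "a = k" | b where "a = Suc b" "k \<le> b"
    by (metis Suc_lessI le_SucE not_less_eq_eq not_le nat_le_linear Suc_le_D le_antisym)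
  then show ?case
  proof cases
    case 1
    then have "x \<otimes> s a = y \<otimes> s a \<otimes> ?c k"
      using xa snoc.prems snoc.hyps descent_gen_below[of a k "Suc m"]
      by (simp add: m_assoc del: descent.simps)
    moreover have "y \<otimes> s a \<in> generated m"
      using 1 k y by (simp add: generated.snoc)
    ultimately show ?thesis using k by blast
  next
    case 2
    then have "x \<otimes> s a = y \<otimes> ?c a"
      using xa k snoc.prems descent_Suc[of a "Suc m"] by (simp del: descent.simps)
    then show ?thesis using y k 2 by (metis Suc_leD)
  next
    case 3
    then have "?c k \<otimes> s a = ?c (Suc k) \<otimes> (s a \<otimes> s a)"
      using snoc.prems snoc.hyps descent_Suc[of k "Suc m"]
      by (simp add: m_assoc gen_closed del: descent.simps)
    then have "x \<otimes> s a = y \<otimes> ?c (Suc k)"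
      using xa snoc.prems snoc.hyps by (simp add: gen_square del: descent.simps)
    then show ?thesis using y 3 snoc.hyps by (metis Suc_leI)
  next
    case 4
    have "s b \<in> carrier G" using 4 snoc.prems snoc.hyps by (simp add: gen_closed)
    then have "x \<otimes> s a = y \<otimes> s b \<otimes> ?c k"
      using xa 4 snoc.prems snoc.hyps descent_gen_above[of k b "Suc m"]
      by (simp add: m_assoc del: descent.simps)
    moreover have "y \<otimes> s b \<in> generated m"
      using 4 snoc.hyps y by (simp add: generated.snoc)
    ultimately show ?thesis using k by blast
  qed
qed

end

text \<open>The product is diagrammatic, to agree with composition of arrows. Taking all bijections
  of the naturals lets permutations of different numbers of strands live in one monoid.\<close>

definition bijection_monoid :: "(nat \<Rightarrow> nat) monoid" where
  "bijection_monoid = \<lparr>carrier = {\<sigma>. bij \<sigma>}, monoid.mult = (\<lambda>\<sigma> \<tau>. \<tau> \<circ> \<sigma>), one = id\<rparr>"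

lemma bijection_monoid_simps [simp]:
  "carrier bijection_monoid = {\<sigma>. bij \<sigma>}"
  "\<sigma> \<otimes>\<^bsub>bijection_monoid\<^esub> \<tau> = \<tau> \<circ> \<sigma>"
  "\<one>\<^bsub>bijection_monoid\<^esub> = id"
  by (simp_all add: bijection_monoid_def)

lemma monoid_bijection_monoid: "monoid bijection_monoid"
  by unfold_locales (auto simp: bij_comp o_assoc)

lemma DirProd_mult [simp]: "x \<otimes>\<^bsub>G \<times>\<times> H\<^esub> y = (fst x \<otimes>\<^bsub>G\<^esub> fst y, snd x \<otimes>\<^bsub>H\<^esub> snd y)"
  by (simp add: DirProd_def split_beta)

section \<open>Words paired with the permutations that they represent\<close>

context coxeter_monoid
begin

text \<open>The relations hold in both components, so normal forms exist for pairs as well.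
  Submonoids of this product serve as the graph of the desired map from permutations to
  \<open>G\<close>.\<close>

lemma coxeter_graph:
  "coxeter_monoid (G \<times>\<times> bijection_monoid) (\<lambda>a. (s a, transpose a (Suc a))) n"
proof -
  interpret P: monoid "G \<times>\<times> bijection_monoid"
    by (intro DirProd_monoid monoid_axioms monoid_bijection_monoid)
  show ?thesis
    by unfold_locales
      (auto intro: gen_commute simp: gen_closed gen_square gen_braid fun_eq_iff transpose_def)
qed

interpretation graph: coxeter_monoid "G \<times>\<times> bijection_monoid" "\<lambda>a. (s a, transpose a (Suc a))" n
  by (rule coxeter_graph)

lemma graph_generated_fixes: "p \<in> graph.generated m \<Longrightarrow> m < i \<Longrightarrow> snd p i = i"
  by (induction rule: graph.generated.induct) (auto simp: transpose_def)

text \<open>In diagrammatic order the transpositions of the run carry m to m - 1, then to m - 2, and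
  finally to k.\<close>

lemma graph_descent_last: "k \<le> m \<Longrightarrow> snd (graph.descent k m) m = k"
  by (induction m) (auto simp: le_Suc_eq)

text \<open>Two pairs over the same permutation have normal forms with the same run, since the
  permutation determines where the run ends. Cancelling the run leaves words in one generator fewer,
  to which the induction hypothesis applies.\<close>

lemma graph_generated_functional:
  assumes "(x, \<sigma>) \<in> graph.generated m" "(y, \<sigma>) \<in> graph.generated m" "m < n"
  shows "x = y"
  using assms
proof (induction m arbitrary: x y \<sigma>)
  case 0
  have "p = \<one>\<^bsub>G \<times>\<times> bijection_monoid\<^esub>" if "p \<in> graph.generated 0" for p
    using that by cases auto
  then show ?case using 0 by (metis prod.inject)
next
  case (Suc m)
  let ?c = "\<lambda>k. graph.descent k (Suc m)"
  obtain x' \<sigma>' k where x': "(x', \<sigma>') \<in> graph.generated m" and k: "k \<le> Suc m"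
    and x: "x = x' \<otimes> fst (?c k)" and \<sigma>: "\<sigma> = snd (?c k) \<circ> \<sigma>'"
    using graph.generated_Suc_normal_form[OF Suc.prems(1,3)]
    by (auto simp del: graph.descent.simps)
  obtain y' \<tau>' l where y': "(y', \<tau>') \<in> graph.generated m" and l: "l \<le> Suc m"
    and y: "y = y' \<otimes> fst (?c l)" and \<tau>: "\<sigma> = snd (?c l) \<circ> \<tau>'"
    using graph.generated_Suc_normal_form[OF Suc.prems(2,3)]
    by (auto simp del: graph.descent.simps)
  \<comment> \<open>The prefixes fix \<open>Suc m\<close>, so its image is computed by the run
    alone.\<close>
  have "\<sigma> (Suc m) = k" "\<sigma> (Suc m) = l"
    using graph_generated_fixes[OF x', of "Suc m"] graph_generated_fixes[OF y', of "Suc m"]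
      fun_cong[OF \<sigma>, of "Suc m"] fun_cong[OF \<tau>, of "Suc m"]
    by (simp_all add: graph_descent_last k l del: graph.descent.simps)
  then have kl: "k = l" by simp
  have "?c k \<in> carrier (G \<times>\<times> bijection_monoid)"
    using Suc.prems graph.descent_closed by blast
  \<comment> \<open>The run acts last, so its injectivity allows it to be cancelled from both
    decompositions.\<close>
  then have "inj (snd (?c k))" by (auto simp: DirProd_def bij_def)
  moreover have "snd (?c k) (\<sigma>' i) = snd (?c k) (\<tau>' i)" for i
    using fun_cong[OF \<sigma>, of i] fun_cong[OF \<tau>, of i] kl by (simp del: graph.descent.simps)
  ultimately have "\<sigma>' = \<tau>'" by (blast dest: injD)
  then have "x' = y'" using Suc.IH x' y' Suc.prems by simp
  then show ?case using x y kl by simp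
qed

end

section \<open>The Coxeter relations for symmetries\<close>

context category
begin

lemma Comp_simps [simp]:
  assumes "f \<in> Arr C" "g \<in> Arr C" "Cod C f = Dom C g"
  shows "f \<Zcomp> g \<in> Arr C" "Dom C (f \<Zcomp> g) = Dom C f" "Cod C (f \<Zcomp> g) = Cod C g"
  using Comp_Hom[of f "Dom C f" "Cod C f" g "Cod C g"] assms by (auto simp: Hom_def)

lemma Id_simps [simp]:
  assumes "X \<in> Obj C"
  shows "Id C X \<in> Arr C" "Dom C (Id C X) = X" "Cod C (Id C X) = X"
  using Id_Hom[OF assms] by (auto simp: Hom_def)

lemma Id_Comp_arr [simp]: "\<lbrakk>f \<in> Arr C; Dom C f = X\<rbrakk> \<Longrightarrow> Id C X \<Zcomp> f = f"
  using Id_Comp[of f X "Cod C f"] by (simp add: Hom_def)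

lemma Comp_Id_arr [simp]: "\<lbrakk>f \<in> Arr C; Cod C f = X\<rbrakk> \<Longrightarrow> f \<Zcomp> Id C X = f"
  using Comp_Id[of f "Dom C f" X] by (simp add: Hom_def)

lemma Comp_assoc_arr:
  "\<lbrakk>f \<in> Arr C; g \<in> Arr C; h \<in> Arr C; Cod C f = Dom C g; Cod C g = Dom C h\<rbrakk>
    \<Longrightarrow> f \<Zcomp> g \<Zcomp> h = f \<Zcomp> (g \<Zcomp> h)"
  using Comp_assoc[of f "Dom C f" "Dom C g" g "Dom C h" h "Cod C h"] by (simp add: Hom_def)

text \<open>Compose with \<open>e'\<close> on the right. This allows an equation to be checked after
  rebracketing its codomain.\<close>

lemma Comp_cancel_retraction:
  assumes "f \<Zcomp> e = g \<Zcomp> e" "e \<Zcomp> e' = Id C X" "f \<in> Hom C W X" "g \<in> Hom C W X"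
    "e \<in> Hom C X Y" "e' \<in> Hom C Y X"
  shows "f = g"
proof -
  have "f = f \<Zcomp> e \<Zcomp> e'"
    by (simp only: Comp_assoc[OF assms(3,5,6)] assms(2) Comp_Id[OF assms(3)])
  also have "\<dots> = g"
    by (simp only: assms(1,2) Comp_assoc[OF assms(4,5,6)] Comp_Id[OF assms(4)])
  finally show ?thesis .
qed

lemma inverse_arrows_unique:
  assumes "inverse_arrows C f g" "inverse_arrows C f h"
  shows "g = h"
proof -
  have Homs: "f \<in> Hom C (Dom C f) (Cod C f)" "g \<in> Hom C (Cod C f) (Dom C f)"
    "h \<in> Hom C (Cod C f) (Dom C f)"
    and fh: "f \<Zcomp> h = Id C (Dom C f)" and gf: "g \<Zcomp> f = Id C (Cod C f)"
    using assms by (simp_all only: inverse_arrows_def Hom_def mem_Collect_eq simp_thms)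
  have "g = g \<Zcomp> (f \<Zcomp> h)" by (simp only: fh Comp_Id[OF Homs(2)])
  also have "\<dots> = g \<Zcomp> f \<Zcomp> h" by (rule Comp_assoc[OF Homs(2,1,3), symmetric])
  also have "\<dots> = h" by (simp only: gf Id_Comp[OF Homs(3)])
  finally show ?thesis .
qed

lemma inverse_arrows_inv_arrow:
  assumes "iso_arrow C f"
  shows "inverse_arrows C f (inv_arrow C f)"
proof -
  obtain g where g: "inverse_arrows C f g"
    using assms by (auto simp: iso_arrow_def)
  show ?thesis
    unfolding inv_arrow_def by (rule theI[where P = "inverse_arrows C f", OF g]) (rule inverse_arrows_unique[OF _ g])
qed

end

section \<open>Associators and padding by identities\<close>

context monoidal_category
begin

declare Unit_Obj [simp] TensorO_Obj [simp]

lemma Tensor_simps [simp]: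
  assumes "f \<in> Arr C" "g \<in> Arr C"
  shows "f \<otimes>\<^sub>m g \<in> Arr C" "Dom C (f \<otimes>\<^sub>m g) = Dom C f \<otimes>\<^sub>o Dom C g"
    "Cod C (f \<otimes>\<^sub>m g) = Cod C f \<otimes>\<^sub>o Cod C g"
  using Tensor_Hom[of f "Dom C f" "Cod C f" g "Dom C g" "Cod C g"] assms by (auto simp: Hom_def)

lemma interchange_arr:
  assumes "f \<in> Arr C" "f' \<in> Arr C" "g \<in> Arr C" "g' \<in> Arr C" "Cod C f = Dom C f'" "Cod C g = Dom C g'"
  shows "f \<otimes>\<^sub>m g \<Zcomp> f' \<otimes>\<^sub>m g' = (f \<Zcomp> f') \<otimes>\<^sub>m (g \<Zcomp> g')"
  using interchange[of f "Dom C f" "Dom C f'" f' "Cod C f'" g "Dom C g" "Dom C g'" g' "Cod C g'"] assms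
  by (simp add: Hom_def)

lemma Assoc_simps [simp]:
  assumes "X \<in> Obj C" "Y \<in> Obj C" "Z \<in> Obj C"
  shows "Assoc C X Y Z \<in> Arr C" "Dom C (Assoc C X Y Z) = (X \<otimes>\<^sub>o Y) \<otimes>\<^sub>o Z"
    "Cod C (Assoc C X Y Z) = X \<otimes>\<^sub>o (Y \<otimes>\<^sub>o Z)"
  using Assoc_Hom[OF assms] by (auto simp: Hom_def)

lemma inv_Assoc_simps [simp]:
  assumes "X \<in> Obj C" "Y \<in> Obj C" "Z \<in> Obj C"
  shows "inv_arrow C (Assoc C X Y Z) \<in> Arr C"
    "Dom C (inv_arrow C (Assoc C X Y Z)) = X \<otimes>\<^sub>o (Y \<otimes>\<^sub>o Z)"
    "Cod C (inv_arrow C (Assoc C X Y Z)) = (X \<otimes>\<^sub>o Y) \<otimes>\<^sub>o Z"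
    "Assoc C X Y Z \<Zcomp> inv_arrow C (Assoc C X Y Z) = Id C ((X \<otimes>\<^sub>o Y) \<otimes>\<^sub>o Z)"
    "inv_arrow C (Assoc C X Y Z) \<Zcomp> Assoc C X Y Z = Id C (X \<otimes>\<^sub>o (Y \<otimes>\<^sub>o Z))"
  using inverse_arrows_inv_arrow[OF Assoc_iso[OF assms]] assms
  by (auto simp: inverse_arrows_def Hom_def)

text \<open>These forms of the inverse laws carry a trailing arrow because composites are normalized
  to right-nested form.\<close>

lemma inv_Assoc_cancel [simp]:
  assumes "X \<in> Obj C" "Y \<in> Obj C" "Z \<in> Obj C" "f \<in> Arr C"
  shows "Dom C f = (X \<otimes>\<^sub>o Y) \<otimes>\<^sub>o Z \<Longrightarrow> Assoc C X Y Z \<Zcomp> (inv_arrow C (Assoc C X Y Z) \<Zcomp> f) = f"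
    "Dom C f = X \<otimes>\<^sub>o (Y \<otimes>\<^sub>o Z) \<Longrightarrow> inv_arrow C (Assoc C X Y Z) \<Zcomp> (Assoc C X Y Z \<Zcomp> f) = f"
  using assms by (simp_all flip: Comp_assoc_arr)

lemma tensor_pow_Obj [simp]: "A \<in> Obj C \<Longrightarrow> tensor_pow C A n \<in> Obj C"
  by (induction n) auto

lemma tensor_id_pow_Hom:
  assumes "A \<in> Obj C" "f \<in> Hom C (tensor_pow C A p) (tensor_pow C A p)"
  shows "tensor_id_pow C A f k \<in> Hom C (tensor_pow C A (p + k)) (tensor_pow C A (p + k))"
  using assms by (induction k) (auto simp: Hom_def)

text \<open>By interchange, padding on the right is functorial. Relations between swaps can
  therefore be checked on an initial block of factors.\<close>

lemma tensor_id_pow_Comp: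
  assumes "A \<in> Obj C" "f \<in> Hom C (tensor_pow C A p) (tensor_pow C A p)"
    "g \<in> Hom C (tensor_pow C A p) (tensor_pow C A p)"
  shows "tensor_id_pow C A (f \<Zcomp> g) k = tensor_id_pow C A f k \<Zcomp> tensor_id_pow C A g k"
proof (induction k)
  case (Suc k)
  then show ?case
    using tensor_id_pow_Hom[OF assms(1,2), of k] tensor_id_pow_Hom[OF assms(1,3), of k] assms(1)
    by (simp add: Hom_def interchange_arr)
qed simp

lemma tensor_id_pow_Id:
  "A \<in> Obj C \<Longrightarrow> tensor_id_pow C A (Id C (tensor_pow C A p)) k = Id C (tensor_pow C A (p + k))"
  by (induction k) (auto simp: Tensor_Id)

lemma tensor_id_pow_add:
  "tensor_id_pow C A (tensor_id_pow C A f k) l = tensor_id_pow C A f (k + l)"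
  by (induction l) auto

end

section \<open>Swapping the last two tensor factors\<close>

context symmetric_monoidal_category
begin

lemma Sym_simps [simp]:
  assumes "X \<in> Obj C" "Y \<in> Obj C"
  shows "Sym C X Y \<in> Arr C" "Dom C (Sym C X Y) = X \<otimes>\<^sub>o Y" "Cod C (Sym C X Y) = Y \<otimes>\<^sub>o X"
  using Sym_Hom[OF assms] by (auto simp: Hom_def)

text \<open>The unpadded core of \<open>adjacent_arrow\<close>. Keeping \<open>P\<close> arbitrary
  makes naturality in \<open>P\<close> available.\<close>

definition last_swap :: "'a \<Rightarrow> 'a \<Rightarrow> 'b" where
  "last_swap P A = Assoc C P A A \<Zcomp> Id C P \<otimes>\<^sub>m Sym C A A \<Zcomp> inv_arrow C (Assoc C P A A)"

lemma last_swap_simps [simp]: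
  assumes "P \<in> Obj C" "A \<in> Obj C"
  shows "last_swap P A \<in> Arr C" "Dom C (last_swap P A) = (P \<otimes>\<^sub>o A) \<otimes>\<^sub>o A"
    "Cod C (last_swap P A) = (P \<otimes>\<^sub>o A) \<otimes>\<^sub>o A"
  using assms by (simp_all add: last_swap_def)

lemma last_swap_square:
  assumes "P \<in> Obj C" "A \<in> Obj C"
  shows "last_swap P A \<Zcomp> last_swap P A = Id C ((P \<otimes>\<^sub>o A) \<otimes>\<^sub>o A)"
proof -
  have "Id C P \<otimes>\<^sub>m Sym C A A \<Zcomp> (Id C P \<otimes>\<^sub>m Sym C A A \<Zcomp> inv_arrow C (Assoc C P A A))
      = inv_arrow C (Assoc C P A A)"
    using assms by (simp add: interchange_arr Sym_Sym Tensor_Id flip: Comp_assoc_arr)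
  then show ?thesis
    using assms by (simp add: last_swap_def Comp_assoc_arr)
qed

text \<open>The arrow \<open>f\<close> passes the associator by naturality, the symmetry by
  interchange, and then the inverse associator. This is the source of the commutation of distant
  swaps.\<close>

lemma last_swap_natural:
  assumes "A \<in> Obj C" "f \<in> Hom C P Q"
  shows "(f \<otimes>\<^sub>m Id C A) \<otimes>\<^sub>m Id C A \<Zcomp> last_swap Q A = last_swap P A \<Zcomp> (f \<otimes>\<^sub>m Id C A) \<otimes>\<^sub>m Id C A"
proof -
  have f: "f \<in> Arr C" "Dom C f = P" "Cod C f = Q" "P \<in> Obj C" "Q \<in> Obj C"
    using assms Dom_Obj Cod_Obj by (auto simp: Hom_def)
  let ?F = "(f \<otimes>\<^sub>m Id C A) \<otimes>\<^sub>m Id C A" and ?F' = "f \<otimes>\<^sub>m (Id C A \<otimes>\<^sub>m Id C A)"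
  let ?a = "\<lambda>X. Assoc C X A A" and ?S = "\<lambda>X. Id C X \<otimes>\<^sub>m Sym C A A"
  have 1: "?F \<Zcomp> ?a Q = ?a P \<Zcomp> ?F'"
    using assms f by (intro Assoc_natural) (auto simp: Hom_def)
  have 2: "?F' \<Zcomp> ?S Q = ?S P \<Zcomp> ?F'"
    using assms f by (simp add: interchange_arr Tensor_Id)
  \<comment> \<open>Naturality of the inverse associator is deduced from \<open>1\<close> by
    cancelling an associator.\<close>
  have 3: "?F' \<Zcomp> inv_arrow C (?a Q) = inv_arrow C (?a P) \<Zcomp> ?F"
  proof (rule Comp_cancel_retraction[OF _ inv_Assoc_simps(4)])
    show "?F' \<Zcomp> inv_arrow C (?a Q) \<Zcomp> ?a Q = inv_arrow C (?a P) \<Zcomp> ?F \<Zcomp> ?a Q"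
      using assms f 1 by (simp add: Comp_assoc_arr)
  qed (use assms f in \<open>auto simp: Hom_def\<close>)
  have "?F \<Zcomp> last_swap Q A = ?a P \<Zcomp> (?F' \<Zcomp> ?S Q) \<Zcomp> inv_arrow C (?a Q)"
    using assms f by (simp add: last_swap_def 1 flip: Comp_assoc_arr)
  also have "\<dots> = ?a P \<Zcomp> ?S P \<Zcomp> (?F' \<Zcomp> inv_arrow C (?a Q))"
    using assms f unfolding 2 by (simp add: Comp_assoc_arr)
  finally show ?thesis
    using assms f unfolding 3 by (simp add: last_swap_def Comp_assoc_arr)
qed

text \<open>The hexagon says that \<open>g\<close> followed by \<open>last_swap A A\<close> is the symmetry of \<open>A\<close> with \<open>A \<otimes> A\<close>, up to
  an associator; its naturality then moves one more swap across.\<close>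

lemma Yang_Baxter:
  assumes "A \<in> Obj C"
  defines "g \<equiv> Sym C A A \<otimes>\<^sub>m Id C A"
  shows "g \<Zcomp> last_swap A A \<Zcomp> g = last_swap A A \<Zcomp> g \<Zcomp> last_swap A A"
proof -
  let ?a = "Assoc C A A A" and ?S = "Sym C A (A \<otimes>\<^sub>o A)"
  have gh: "g \<Zcomp> last_swap A A = ?a \<Zcomp> ?S"
  proof (rule Comp_cancel_retraction[OF _ inv_Assoc_simps(4)])
    show "g \<Zcomp> last_swap A A \<Zcomp> ?a = ?a \<Zcomp> ?S \<Zcomp> ?a"
      using assms hexagon[of A A A] by (simp add: last_swap_def Comp_assoc_arr)
  qed (use assms in \<open>auto simp: Hom_def\<close>)
  have nat: "Id C A \<otimes>\<^sub>m Sym C A A \<Zcomp> ?S = ?S \<Zcomp> g"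
    unfolding g_def using assms by (intro Sym_natural) (auto simp: Hom_def)
  have "g \<Zcomp> last_swap A A \<Zcomp> g = ?a \<Zcomp> (Id C A \<otimes>\<^sub>m Sym C A A \<Zcomp> ?S)"
    unfolding gh nat using assms by (simp add: Comp_assoc_arr)
  also have "\<dots> = last_swap A A \<Zcomp> (?a \<Zcomp> ?S)"
    using assms by (simp add: last_swap_def Comp_assoc_arr)
  finally show ?thesis
    using assms by (simp add: Comp_assoc_arr flip: gh)
qed

text \<open>Rebracketing along \<open>\<theta>\<close> turns both swaps into arrows of the form \<open>Id P \<otimes> x\<close>, which reduces
  the relation to the preceding one.\<close>

lemma last_swap_braid:
  assumes P: "P \<in> Obj C" and A: "A \<in> Obj C"
  defines "b \<equiv> last_swap P A \<otimes>\<^sub>m Id C A" and "c \<equiv> last_swap (P \<otimes>\<^sub>o A) A"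
  shows "b \<Zcomp> c \<Zcomp> b = c \<Zcomp> b \<Zcomp> c"
proof -
  define g where "g = Sym C A A \<otimes>\<^sub>m Id C A"
  let ?h = "last_swap A A" and ?I = "Id C P"
  let ?a = "Assoc C P A A \<otimes>\<^sub>m Id C A" and ?d = "Assoc C P (A \<otimes>\<^sub>o A) A"
  define \<theta> where "\<theta> = ?a \<Zcomp> ?d"
  define \<theta>' where
    "\<theta>' = inv_arrow C ?d \<Zcomp> inv_arrow C (Assoc C P A A) \<otimes>\<^sub>m Id C A"
  note [simp] = P A
  have g [simp]: "g \<in> Arr C" "Dom C g = (A \<otimes>\<^sub>o A) \<otimes>\<^sub>o A" "Cod C g = (A \<otimes>\<^sub>o A) \<otimes>\<^sub>o A"
    by (simp_all add: g_def)
  have bc [simp]: "b \<in> Arr C" "c \<in> Arr C"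
    "Dom C b = ((P \<otimes>\<^sub>o A) \<otimes>\<^sub>o A) \<otimes>\<^sub>o A" "Cod C b = ((P \<otimes>\<^sub>o A) \<otimes>\<^sub>o A) \<otimes>\<^sub>o A"
    "Dom C c = ((P \<otimes>\<^sub>o A) \<otimes>\<^sub>o A) \<otimes>\<^sub>o A" "Cod C c = ((P \<otimes>\<^sub>o A) \<otimes>\<^sub>o A) \<otimes>\<^sub>o A"
    by (simp_all add: b_def c_def)
  have \<theta> [simp]: "\<theta> \<in> Arr C" "Dom C \<theta> = ((P \<otimes>\<^sub>o A) \<otimes>\<^sub>o A) \<otimes>\<^sub>o A"
    "Cod C \<theta> = P \<otimes>\<^sub>o ((A \<otimes>\<^sub>o A) \<otimes>\<^sub>o A)"
    by (simp_all add: \<theta>_def)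
  have inv: "\<theta> \<Zcomp> \<theta>' = Id C (((P \<otimes>\<^sub>o A) \<otimes>\<^sub>o A) \<otimes>\<^sub>o A)"
    by (simp add: \<theta>_def \<theta>'_def Comp_assoc_arr) (simp add: interchange_arr Tensor_Id)
  have b\<theta>: "b \<Zcomp> \<theta> = \<theta> \<Zcomp> ?I \<otimes>\<^sub>m g"
  proof -
    have "b \<Zcomp> ?a = ?a \<Zcomp> (?I \<otimes>\<^sub>m Sym C A A) \<otimes>\<^sub>m Id C A"
      by (simp add: b_def last_swap_def interchange_arr Comp_assoc_arr)
    moreover have "(?I \<otimes>\<^sub>m Sym C A A) \<otimes>\<^sub>m Id C A \<Zcomp> ?d = ?d \<Zcomp> ?I \<otimes>\<^sub>m g"
      unfolding g_def by (intro Assoc_natural) (auto simp: Hom_def)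
    ultimately have "b \<Zcomp> ?a \<Zcomp> ?d = ?a \<Zcomp> (?d \<Zcomp> ?I \<otimes>\<^sub>m g)"
      by (simp add: Comp_assoc_arr)
    then show ?thesis by (simp add: \<theta>_def Comp_assoc_arr)
  qed
  \<comment> \<open>The equation is checked after one more associator \<open>?i\<close>, where the
    pentagon replaces \<theta> by the two associators adapted to \<open>c\<close>.\<close>
  have c\<theta>: "c \<Zcomp> \<theta> = \<theta> \<Zcomp> ?I \<otimes>\<^sub>m ?h"
  proof (rule Comp_cancel_retraction)
    let ?e = "Assoc C (P \<otimes>\<^sub>o A) A A" and ?f = "Assoc C P A (A \<otimes>\<^sub>o A)"
      and ?i = "?I \<otimes>\<^sub>m Assoc C A A A"
    have pent: "\<theta> \<Zcomp> ?i = ?e \<Zcomp> ?f"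
      unfolding \<theta>_def using pentagon[of P A A A] by simp
    have nat: "Id C (P \<otimes>\<^sub>o A) \<otimes>\<^sub>m Sym C A A \<Zcomp> ?f = ?f \<Zcomp> ?I \<otimes>\<^sub>m (Id C A \<otimes>\<^sub>m Sym C A A)"
      using Assoc_natural[of ?I P P "Id C A" A A "Sym C A A" "A \<otimes>\<^sub>o A" "A \<otimes>\<^sub>o A"]
      by (simp add: Hom_def Tensor_Id)
    have "c \<Zcomp> \<theta> \<Zcomp> ?i = c \<Zcomp> (?e \<Zcomp> ?f)"
      by (simp add: Comp_assoc_arr pent)
    also have "\<dots> = ?e \<Zcomp> (Id C (P \<otimes>\<^sub>o A) \<otimes>\<^sub>m Sym C A A \<Zcomp> ?f)"
      by (simp add: c_def last_swap_def Comp_assoc_arr)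
    also have "\<dots> = \<theta> \<Zcomp> ?i \<Zcomp> ?I \<otimes>\<^sub>m (Id C A \<otimes>\<^sub>m Sym C A A)"
      unfolding nat pent by (simp add: Comp_assoc_arr)
    also have "\<dots> = \<theta> \<Zcomp> ?I \<otimes>\<^sub>m ?h \<Zcomp> ?i"
      by (simp add: Comp_assoc_arr interchange_arr last_swap_def)
    finally show "c \<Zcomp> \<theta> \<Zcomp> ?i = \<theta> \<Zcomp> ?I \<otimes>\<^sub>m ?h \<Zcomp> ?i" .
    show "?i \<Zcomp> ?I \<otimes>\<^sub>m inv_arrow C (Assoc C A A A) = Id C (P \<otimes>\<^sub>o ((A \<otimes>\<^sub>o A) \<otimes>\<^sub>o A))"
      by (simp add: interchange_arr Tensor_Id)
  qed (auto simp: Hom_def)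
  \<comment> \<open>Correspondence along \<theta> is preserved by composition, so it passes from the
    two swaps to both sides of the braid relation.\<close>
  define intertwined where "intertwined x x' \<longleftrightarrow>
      x \<in> Hom C (Dom C \<theta>) (Dom C \<theta>) \<and> x' \<in> Hom C (Dom C g) (Dom C g) \<and>
      x \<Zcomp> \<theta> = \<theta> \<Zcomp> ?I \<otimes>\<^sub>m x'" for x x'
  have comp: "intertwined (x \<Zcomp> y) (x' \<Zcomp> y')"
    if "intertwined x x'" "intertwined y y'" for x x' y y'
  proof -
    have *: "x \<in> Arr C" "y \<in> Arr C" "x' \<in> Arr C" "y' \<in> Arr C"
      "Dom C x = Dom C \<theta>" "Cod C x = Dom C \<theta>" "Dom C y = Dom C \<theta>" "Cod C y = Dom C \<theta>"
      "Dom C x' = Dom C g" "Cod C x' = Dom C g" "Dom C y' = Dom C g" "Cod C y' = Dom C g"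
      and x: "x \<Zcomp> \<theta> = \<theta> \<Zcomp> ?I \<otimes>\<^sub>m x'" and y: "y \<Zcomp> \<theta> = \<theta> \<Zcomp> ?I \<otimes>\<^sub>m y'"
      using that by (simp_all add: intertwined_def Hom_def)
    have "x \<Zcomp> y \<Zcomp> \<theta> = x \<Zcomp> (y \<Zcomp> \<theta>)"
      using * by (simp add: Comp_assoc_arr)
    also have "\<dots> = (x \<Zcomp> \<theta>) \<Zcomp> ?I \<otimes>\<^sub>m y'"
      unfolding y using * by (simp add: Comp_assoc_arr)
    also have "\<dots> = \<theta> \<Zcomp> ?I \<otimes>\<^sub>m (x' \<Zcomp> y')"
      unfolding x using * by (simp add: Comp_assoc_arr interchange_arr)
    finally show ?thesis using * by (simp add: intertwined_def Hom_def)
  qed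
  have "intertwined b g" "intertwined c ?h"
    using b\<theta> c\<theta> by (simp_all add: intertwined_def Hom_def)
  then have "intertwined (b \<Zcomp> c \<Zcomp> b) (g \<Zcomp> ?h \<Zcomp> g)" "intertwined (c \<Zcomp> b \<Zcomp> c) (?h \<Zcomp> g \<Zcomp> ?h)"
    by (blast intro: comp)+
  then have "b \<Zcomp> c \<Zcomp> b \<Zcomp> \<theta> = c \<Zcomp> b \<Zcomp> c \<Zcomp> \<theta>"
    using Yang_Baxter[OF A] by (simp add: intertwined_def g_def)
  then show ?thesis
    by (rule Comp_cancel_retraction[OF _ inv]) (auto simp: Hom_def \<theta>'_def)
qed

end

section \<open>The action of the symmetric group\<close>

definition endo_monoid :: "('o, 'm, 'z) smc_data_scheme \<Rightarrow> 'o \<Rightarrow> 'm monoid" where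
  "endo_monoid C X = \<lparr>carrier = Hom C X X, monoid.mult = Comp C, one = Id C X\<rparr>"

lemma endo_monoid_simps [simp]:
  "carrier (endo_monoid C X) = Hom C X X"
  "f \<otimes>\<^bsub>endo_monoid C X\<^esub> g = f \<Zcomp>\<^bsub>C\<^esub> g"
  "\<one>\<^bsub>endo_monoid C X\<^esub> = Id C X"
  by (simp_all add: endo_monoid_def)

lemma (in category) monoid_endo_monoid: "X \<in> Obj C \<Longrightarrow> monoid (endo_monoid C X)"
  by unfold_locales (auto intro: Comp_Hom Id_Hom Id_Comp Comp_Id Comp_assoc)

context symmetric_monoidal_category
begin

lemma last_swap_pow_Hom:
  "A \<in> Obj C \<Longrightarrow> last_swap (tensor_pow C A a) A
    \<in> Hom C (tensor_pow C A (Suc (Suc a))) (tensor_pow C A (Suc (Suc a)))"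
  by (simp add: Hom_def)

text \<open>The witness \<open>d\<close> replaces the truncated subtraction in
  \<open>adjacent_arrow\<close> by the number of factors to the right of the swap.\<close>

lemma adjacent_arrow_eq:
  assumes "n = Suc (Suc a) + d"
  shows "adjacent_arrow C A n a = tensor_id_pow C A (last_swap (tensor_pow C A a) A) d"
  using assms by (simp add: adjacent_arrow_def last_swap_def Let_def)

lemma adjacent_arrow_Hom:
  assumes "A \<in> Obj C" "Suc a < n"
  shows "adjacent_arrow C A n a \<in> Hom C (tensor_pow C A n) (tensor_pow C A n)"
proof -
  obtain d where "n = Suc (Suc a) + d"
    using assms(2) by (metis Suc_leI le_Suc_ex)
  then show ?thesis
    using tensor_id_pow_Hom[OF assms(1) last_swap_pow_Hom[OF assms(1)], of a d]
    by (simp add: adjacent_arrow_eq)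
qed

lemma adjacent_arrow_square:
  assumes A: "A \<in> Obj C" and "Suc a < n"
  shows "adjacent_arrow C A n a \<Zcomp> adjacent_arrow C A n a = Id C (tensor_pow C A n)"
proof -
  obtain d where n: "n = Suc (Suc a) + d"
    using assms(2) by (metis Suc_leI le_Suc_ex)
  let ?c = "last_swap (tensor_pow C A a) A"
  have "?c \<Zcomp> ?c = Id C (tensor_pow C A (Suc (Suc a)))"
    using A by (simp add: last_swap_square)
  then show ?thesis
    using tensor_id_pow_Comp[OF A last_swap_pow_Hom[OF A] last_swap_pow_Hom[OF A], of a d]
      tensor_id_pow_Id[OF A, of "Suc (Suc a)" d]
    unfolding adjacent_arrow_eq[OF n] by (simp only: n)
qed

text \<open>Both arrows are paddings of arrows on the first b + 2 factors, and there they commute by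
  naturality of the last swap.\<close>

lemma adjacent_arrow_commute:
  assumes A: "A \<in> Obj C" and "Suc a < b" "Suc b < n"
  shows "adjacent_arrow C A n a \<Zcomp> adjacent_arrow C A n b
    = adjacent_arrow C A n b \<Zcomp> adjacent_arrow C A n a"
proof -
  obtain k where b: "b = Suc (Suc a) + k"
    using assms(2) by (metis Suc_leI le_Suc_ex)
  obtain d where n: "n = Suc (Suc b) + d"
    using assms(3) by (metis Suc_leI le_Suc_ex)
  \<comment> \<open>The swap at \<open>a\<close>, padded to the first \<open>b\<close> factors;
    \<open>?F\<close> adds the factors \<open>b\<close> and \<open>b + 1\<close>, which the other
    swap exchanges.\<close>
  define f where "f = tensor_id_pow C A (last_swap (tensor_pow C A a) A) k"
  let ?F = "(f \<otimes>\<^sub>m Id C A) \<otimes>\<^sub>m Id C A" and ?P = "tensor_pow C A b"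
  have f: "f \<in> Hom C ?P ?P"
    unfolding f_def b by (rule tensor_id_pow_Hom[OF A last_swap_pow_Hom[OF A]])
  then have F: "?F \<in> Hom C (tensor_pow C A (Suc (Suc b))) (tensor_pow C A (Suc (Suc b)))"
    using A by (simp add: Hom_def)
  have na: "n = Suc (Suc a) + (Suc (Suc k) + d)" by (simp add: n b)
  have "adjacent_arrow C A n a = tensor_id_pow C A ?F d"
    unfolding adjacent_arrow_eq[OF na] tensor_id_pow_add[symmetric] by (simp add: f_def)
  then show ?thesis
    using tensor_id_pow_Comp[OF A F last_swap_pow_Hom[OF A], of d]
      tensor_id_pow_Comp[OF A last_swap_pow_Hom[OF A] F, of d]
      last_swap_natural[OF A f]
    by (simp only: adjacent_arrow_eq[OF n])
qed

lemma adjacent_arrow_braid: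
  assumes A: "A \<in> Obj C" and "Suc (Suc a) < n"
  defines "s \<equiv> adjacent_arrow C A n"
  shows "s a \<Zcomp> s (Suc a) \<Zcomp> s a = s (Suc a) \<Zcomp> s a \<Zcomp> s (Suc a)"
proof -
  obtain d where n: "n = Suc (Suc (Suc a)) + d"
    using assms(2) by (metis Suc_leI le_Suc_ex)
  let ?P = "tensor_pow C A a" and ?X = "tensor_pow C A (Suc (Suc (Suc a)))"
  let ?b = "last_swap ?P A \<otimes>\<^sub>m Id C A" and ?c = "last_swap (?P \<otimes>\<^sub>o A) A"
  have b: "?b \<in> Hom C ?X ?X" and c: "?c \<in> Hom C ?X ?X"
    using A by (simp_all add: Hom_def)
  \<comment> \<open>One trailing identity is split off, so that both swaps become paddings of arrows
    on the same object \<open>?X\<close>.\<close>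
  have na: "n = Suc (Suc a) + (Suc 0 + d)" by (simp add: n)
  have sa: "s a = tensor_id_pow C A ?b d"
    unfolding s_def adjacent_arrow_eq[OF na] tensor_id_pow_add[symmetric] by simp
  have sb: "s (Suc a) = tensor_id_pow C A ?c d"
    unfolding s_def adjacent_arrow_eq[OF n] by simp
  have "?b \<Zcomp> ?c \<Zcomp> ?b = ?c \<Zcomp> ?b \<Zcomp> ?c"
    using A by (simp add: last_swap_braid)
  moreover have "tensor_id_pow C A (f \<Zcomp> g \<Zcomp> h) d
      = tensor_id_pow C A f d \<Zcomp> tensor_id_pow C A g d \<Zcomp> tensor_id_pow C A h d"
    if "f \<in> Hom C ?X ?X" "g \<in> Hom C ?X ?X" "h \<in> Hom C ?X ?X" for f g h
    by (simp only: tensor_id_pow_Comp[OF A Comp_Hom[OF that(1,2)] that(3)]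
        tensor_id_pow_Comp[OF A that(1,2)])
  ultimately show ?thesis
    using b c by (metis sa sb)
qed

text \<open>The number of strands is \<open>Suc (n - 1)\<close> rather than \<open>n\<close> to cover \<open>n = 0\<close>.\<close>

lemma coxeter_adjacent_arrow:
  assumes "A \<in> Obj C"
  shows "coxeter_monoid (endo_monoid C (tensor_pow C A n)) (adjacent_arrow C A n) (Suc (n - 1))"
proof -
  interpret monoid "endo_monoid C (tensor_pow C A n)"
    using assms by (intro monoid_endo_monoid) simp
  show ?thesis
    using assms
    by unfold_locales
      (auto intro: adjacent_arrow_Hom adjacent_arrow_square adjacent_arrow_commute
        adjacent_arrow_braid)
qed

text \<open>A derivation of \<open>perm_acts\<close> spells a word in the pairs of a swap and its
  transposition, and such words form a functional relation.\<close>

lemma perm_acts_functional: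
  assumes A: "A \<in> Obj C" and "perm_acts C A n \<sigma> f" "perm_acts C A n \<sigma> g"
  shows "f = g"
proof -
  let ?P = "tensor_pow C A n"
  interpret E: coxeter_monoid "endo_monoid C ?P" "adjacent_arrow C A n" "Suc (n - 1)"
    by (rule coxeter_adjacent_arrow[OF A])
  interpret graph: coxeter_monoid "endo_monoid C ?P \<times>\<times> bijection_monoid"
    "\<lambda>a. (adjacent_arrow C A n a, transpose a (Suc a))" "Suc (n - 1)"
    by (rule E.coxeter_graph)
  \<comment> \<open>On n strands the swaps are numbered 0, ..., n - 2, which makes n - 1 the bound
    for words; for n = 0 only the empty word remains.\<close>
  have "(h, \<tau>) \<in> graph.generated (n - 1)" if "perm_acts C A n \<tau> h" for \<tau> h
    using that
  proof induction
    case ident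
    then show ?case using graph.generated.one by (simp add: id_def)
  next
    case (adjacent a)
    then show ?case by (intro graph.generated_gen) auto
  next
    case (product \<sigma> f \<tau> g)
    then show ?case
      using graph.generated_mult[of "(g, \<tau>)" "n - 1" "(f, \<sigma>)"] by (simp add: comp_def)
  qed
  then show ?thesis
    using assms E.graph_generated_functional by blast
qed

lemma perm_acts_Hom:
  "\<lbrakk>perm_acts C A n \<sigma> f; A \<in> Obj C\<rbrakk> \<Longrightarrow> f \<in> Hom C (tensor_pow C A n) (tensor_pow C A n)"
  by (induction rule: perm_acts.induct)
    (auto intro: adjacent_arrow_Hom Comp_Hom Id_Hom)

end

section \<open>Adjacent transpositions generate all permutations\<close>

lemma perm_acts_transpose_exists:
  assumes "a < b" "b < n"
  shows "\<exists>f. perm_acts C A n (transpose a b) f"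
  using assms
proof (induction b)
  case (Suc b)
  show ?case
  proof (cases "a = b")
    case True
    show ?thesis unfolding True by (rule exI, rule perm_acts.adjacent[OF Suc.prems(2)])
  next
    case False
    then have "a < b" "b < n" using Suc.prems by simp_all
    then obtain f where f: "perm_acts C A n (transpose a b) f"
      using Suc.IH by blast
    note adj = perm_acts.adjacent[OF Suc.prems(2), of C A]
    \<comment> \<open>Conjugating (a b) by the adjacent transposition (b b+1) moves its upper end up
      by one.\<close>
    have "transpose b (Suc b) \<circ> (transpose a b \<circ> transpose b (Suc b)) = transpose a (Suc b)"
      using False Suc.prems by (auto simp: fun_eq_iff transpose_def)
    then show ?thesis
      using perm_acts.product[OF perm_acts.product[OF adj f] adj] by (metis (no_types))
  qed
qed simp

lemma perm_acts_exists:
  assumes "\<sigma> permutes {..<n}"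
  shows "\<exists>f. perm_acts C A n \<sigma> f"
  using assms finite_lessThan[of n]
proof (induction rule: permutes_induct)
  case id
  show ?case by (rule exI, rule perm_acts.ident)
next
  case (swap a b p)
  have "\<exists>f. perm_acts C A n (transpose a b) f"
  proof (cases "a < b")
    case True
    then show ?thesis using swap.hyps perm_acts_transpose_exists by simp
  next
    case False
    then show ?thesis
      using swap.hyps perm_acts_transpose_exists[of b a n] by (simp add: transpose_commute)
  qed
  then obtain f where f: "perm_acts C A n (transpose a b) f" ..
  obtain g where g: "perm_acts C A n p g"
    using swap.IH ..
  show ?case by (rule exI, rule perm_acts.product[OF g f])
qed

context symmetric_monoidal_category
begin

lemma perm_arrow_eq: "\<lbrakk>A \<in> Obj C; perm_acts C A n \<sigma> f\<rbrakk> \<Longrightarrow> perm_arrow C A n \<sigma> = f"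
  unfolding perm_arrow_def by (rule the_equality) (auto dest: perm_acts_functional)

lemma perm_acts_perm_arrow:
  "\<lbrakk>A \<in> Obj C; \<sigma> permutes {..<n}\<rbrakk> \<Longrightarrow> perm_acts C A n \<sigma> (perm_arrow C A n \<sigma>)"
  using perm_acts_exists[of \<sigma> n C A] perm_arrow_eq by auto

lemma perm_arrow_Hom:
  "\<lbrakk>A \<in> Obj C; \<sigma> permutes {..<n}\<rbrakk>
    \<Longrightarrow> perm_arrow C A n \<sigma> \<in> Hom C (tensor_pow C A n) (tensor_pow C A n)"
  by (blast intro: perm_acts_Hom perm_acts_perm_arrow)

lemma perm_arrow_id: "A \<in> Obj C \<Longrightarrow> perm_arrow C A n id = Id C (tensor_pow C A n)"
  by (intro perm_arrow_eq perm_acts.ident)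

lemma perm_arrow_Comp:
  assumes "A \<in> Obj C" "\<sigma> permutes {..<n}" "\<tau> permutes {..<n}"
  shows "perm_arrow C A n \<sigma> \<Zcomp> perm_arrow C A n \<tau> = perm_arrow C A n (\<tau> \<circ> \<sigma>)"
  using assms by (intro perm_arrow_eq[symmetric] perm_acts.product perm_acts_perm_arrow)

end

section \<open>The symmetrizer\<close>

lemma hom_monoid_simps [simp]:
  "carrier (hom_monoid C X Y) = Hom C X Y"
  "f \<otimes>\<^bsub>hom_monoid C X Y\<^esub> g = f \<oplus>\<^sub>m\<^bsub>C\<^esub> g"
  "\<one>\<^bsub>hom_monoid C X Y\<^esub> = Zero C X Y"
  by (simp_all add: hom_monoid_def)

section \<open>Finite sums and averages of arrows\<close>

context nonneg_rat_linear_smc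
begin

lemma finprod_Comp_left:
  assumes "finite S" "f \<in> S \<rightarrow> Hom C X Y" "h \<in> Hom C Y Z" "X \<in> Obj C"
  shows "finprod (hom_monoid C X Y) f S \<Zcomp> h = finprod (hom_monoid C X Z) (\<lambda>i. f i \<Zcomp> h) S"
proof -
  have "Y \<in> Obj C" "Z \<in> Obj C" using assms Dom_Obj Cod_Obj by (auto simp: Hom_def)
  then interpret XY: comm_monoid "hom_monoid C X Y" + XZ: comm_monoid "hom_monoid C X Z"
    using assms hom_comm_monoid by auto
  show ?thesis
    using assms(1,2)
  proof (induction S)
    case empty
    then show ?case using assms by (simp add: Comp_Zero_left)
  next
    case (insert i S)
    then have "f i \<in> Hom C X Y" "f \<in> S \<rightarrow> Hom C X Y" by auto
    moreover from this have "(\<lambda>i. f i \<Zcomp> h) \<in> S \<rightarrow> Hom C X Z" "f i \<Zcomp> h \<in> Hom C X Z"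
      using assms(3) Comp_Hom by blast+
    moreover have "finprod (hom_monoid C X Y) f S \<in> Hom C X Y"
      using XY.finprod_closed[of f S] \<open>f \<in> S \<rightarrow> Hom C X Y\<close> by simp
    ultimately show ?case
      using insert assms(3) by (simp add: Comp_Plus_left)
  qed
qed

lemma finprod_Comp_right:
  assumes "finite S" "f \<in> S \<rightarrow> Hom C Y Z" "h \<in> Hom C X Y" "Z \<in> Obj C"
  shows "h \<Zcomp> finprod (hom_monoid C Y Z) f S = finprod (hom_monoid C X Z) (\<lambda>i. h \<Zcomp> f i) S"
proof -
  have "X \<in> Obj C" "Y \<in> Obj C" using assms Dom_Obj Cod_Obj by (auto simp: Hom_def)
  then interpret YZ: comm_monoid "hom_monoid C Y Z" + XZ: comm_monoid "hom_monoid C X Z"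
    using assms hom_comm_monoid by auto
  show ?thesis
    using assms(1,2)
  proof (induction S)
    case empty
    then show ?case using assms by (simp add: Comp_Zero_right)
  next
    case (insert i S)
    then have "f i \<in> Hom C Y Z" "f \<in> S \<rightarrow> Hom C Y Z" by auto
    moreover from this have "(\<lambda>i. h \<Zcomp> f i) \<in> S \<rightarrow> Hom C X Z" "h \<Zcomp> f i \<in> Hom C X Z"
      using assms(3) Comp_Hom by blast+
    moreover have "finprod (hom_monoid C Y Z) f S \<in> Hom C Y Z"
      using YZ.finprod_closed[of f S] \<open>f \<in> S \<rightarrow> Hom C Y Z\<close> by simp
    ultimately show ?case
      using insert assms(3) by (simp add: Comp_Plus_right)
  qed
qed

lemma finprod_const_Scale:
  assumes "finite S" "w \<in> Hom C X Y"
  shows "finprod (hom_monoid C X Y) (\<lambda>_. w) S = rat_of_nat (card S) \<cdot>\<^sub>m w"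
proof -
  have "X \<in> Obj C" "Y \<in> Obj C" using assms Dom_Obj Cod_Obj by (auto simp: Hom_def)
  then interpret comm_monoid "hom_monoid C X Y"
    by (rule hom_comm_monoid)
  show ?thesis
    using assms(1)
  proof (induction S)
    case empty
    then show ?case using assms by (simp add: zero_Scale)
  next
    case (insert i S)
    then show ?case
      using assms(2) by (simp add: plus_Scale one_Scale)
  qed
qed

text \<open>Counting permutations turns the sum into n! times \<open>w\<close>, and
  \<open>mult_Scale\<close> cancels 1/n! against n!.\<close>

lemma average_const:
  assumes "w \<in> Hom C X Y"
  shows "(1 / fact n) \<cdot>\<^sub>m finprod (hom_monoid C X Y) (\<lambda>_. w) {\<sigma>. \<sigma> permutes {..<n}} = w"
proof -
  have "card {\<sigma>. \<sigma> permutes {..<n}} = fact n"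
    by (rule card_permutations) auto
  then show ?thesis
    using assms mult_Scale[of "1 / fact n" "fact n" w X Y]
    by (simp add: finprod_const_Scale finite_permutations one_Scale)
qed

section \<open>Absorption properties of the symmetrizer\<close>

context
  fixes A :: 'o and n :: nat
  assumes A: "A \<in> Obj C"
begin

private abbreviation (input) "P \<equiv> tensor_pow C A n"
private abbreviation (input) "perms \<equiv> {\<sigma>. \<sigma> permutes {..<n}}"

lemma perm_arrow_funcset: "perm_arrow C A n \<in> perms \<rightarrow> Hom C P P"
  using perm_arrow_Hom[OF A] by blast

lemma finite_perms: "finite perms"
  by (simp add: finite_permutations)

lemma perm_sum_Hom: "finprod (hom_monoid C P P) (perm_arrow C A n) perms \<in> Hom C P P"
proof -
  interpret comm_monoid "hom_monoid C P P" using A by (simp add: hom_comm_monoid)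
  show ?thesis using finprod_closed[of "perm_arrow C A n" perms] perm_arrow_funcset by simp
qed

lemma symmetrizer_Hom: "symmetrizer C A n \<in> Hom C P P"
  unfolding symmetrizer_def Let_def by (intro Scale_Hom perm_sum_Hom) simp

lemma symmetrizer_Comp:
  assumes "w \<in> Hom C P Z"
  shows "symmetrizer C A n \<Zcomp> w
    = (1 / fact n) \<cdot>\<^sub>m finprod (hom_monoid C P Z) (\<lambda>\<sigma>. perm_arrow C A n \<sigma> \<Zcomp> w) perms"
  using finprod_Comp_left[OF finite_perms perm_arrow_funcset assms]
    Comp_Scale_left[OF _ perm_sum_Hom assms] A
  by (simp add: symmetrizer_def Let_def)

lemma Comp_symmetrizer:
  assumes "w \<in> Hom C Z P"
  shows "w \<Zcomp> symmetrizer C A n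
    = (1 / fact n) \<cdot>\<^sub>m finprod (hom_monoid C Z P) (\<lambda>\<sigma>. w \<Zcomp> perm_arrow C A n \<sigma>) perms"
  using finprod_Comp_right[OF finite_perms perm_arrow_funcset assms]
    Comp_Scale_right[OF _ assms perm_sum_Hom] A
  by (simp add: symmetrizer_def Let_def)

text \<open>Composing each summand with \<tau> only reindexes the sum along the bijection
  \<open>(\<circ>) \<tau>\<close> of the permutations.\<close>

lemma symmetrizer_perm_arrow:
  assumes \<tau>: "\<tau> permutes {..<n}"
  shows "symmetrizer C A n \<Zcomp> perm_arrow C A n \<tau> = symmetrizer C A n"
proof -
  interpret comm_monoid "hom_monoid C P P" using A by (simp add: hom_comm_monoid)
  have im: "(\<circ>) \<tau> ` perms = perms"
    using image_compose_permutations_left[OF \<tau>] by (simp add: setcompr_eq_image)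
  have inj: "inj_on ((\<circ>) \<tau>) perms"
    using fun.inj_map[OF permutes_inj[OF \<tau>]] by (rule inj_on_subset) simp
  have "finprod (hom_monoid C P P) (\<lambda>\<sigma>. perm_arrow C A n \<sigma> \<Zcomp> perm_arrow C A n \<tau>) perms
      = finprod (hom_monoid C P P) (\<lambda>\<sigma>. perm_arrow C A n (\<tau> \<circ> \<sigma>)) perms"
    using \<tau> A by (intro finprod_cong') (auto simp: perm_arrow_Comp intro!: perm_arrow_Hom permutes_compose)
  also have "\<dots> = finprod (hom_monoid C P P) (perm_arrow C A n) perms"
    using finprod_reindex[of "perm_arrow C A n" "(\<circ>) \<tau>" perms] inj perm_arrow_funcset
    unfolding im by simp
  finally show ?thesis
    using symmetrizer_Comp[OF perm_arrow_Hom[OF A \<tau>]] by (simp add: symmetrizer_def Let_def)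
qed

text \<open>Here the reindexing precomposes with \<tau>, and its injectivity comes from the
  surjectivity of \<tau>.\<close>

lemma perm_arrow_symmetrizer:
  assumes \<tau>: "\<tau> permutes {..<n}"
  shows "perm_arrow C A n \<tau> \<Zcomp> symmetrizer C A n = symmetrizer C A n"
proof -
  interpret comm_monoid "hom_monoid C P P" using A by (simp add: hom_comm_monoid)
  have im: "(\<lambda>\<sigma>. \<sigma> \<circ> \<tau>) ` perms = perms"
    using image_compose_permutations_right[OF \<tau>] by (simp add: setcompr_eq_image)
  have inj: "inj_on (\<lambda>\<sigma>. \<sigma> \<circ> \<tau>) perms"
    using permutes_surj[OF \<tau>] by (auto intro!: inj_onI simp: surj_fun_eq)
  have "finprod (hom_monoid C P P) (\<lambda>\<sigma>. perm_arrow C A n \<tau> \<Zcomp> perm_arrow C A n \<sigma>) perms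
      = finprod (hom_monoid C P P) (\<lambda>\<sigma>. perm_arrow C A n (\<sigma> \<circ> \<tau>)) perms"
    using \<tau> A by (intro finprod_cong') (auto simp: perm_arrow_Comp intro!: perm_arrow_Hom permutes_compose)
  also have "\<dots> = finprod (hom_monoid C P P) (perm_arrow C A n) perms"
    using finprod_reindex[of "perm_arrow C A n" "\<lambda>\<sigma>. \<sigma> \<circ> \<tau>" perms] inj perm_arrow_funcset
    unfolding im by simp
  finally show ?thesis
    using Comp_symmetrizer[OF perm_arrow_Hom[OF A \<tau>]] by (simp add: symmetrizer_def Let_def)
qed

lemma perm_arrow_in_diagram: "\<sigma> permutes {..<n} \<Longrightarrow> perm_arrow C A n \<sigma> \<in> perm_diagram C A n"
  by (simp add: perm_diagram_def)

text \<open>The identity belongs to the diagram, so every permutation followed by \<open>w\<close>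
  equals \<open>w\<close>, and the average of equal terms is \<open>w\<close>.\<close>

lemma symmetrizer_absorb_left:
  assumes w: "w \<in> Hom C P Z"
    and eq: "\<forall>f\<in>perm_diagram C A n. \<forall>g\<in>perm_diagram C A n. f \<Zcomp> w = g \<Zcomp> w"
  shows "symmetrizer C A n \<Zcomp> w = w"
proof -
  have "Z \<in> Obj C" using w Cod_Obj by (auto simp: Hom_def)
  then interpret comm_monoid "hom_monoid C P Z" using A by (simp add: hom_comm_monoid)
  have "perm_arrow C A n \<sigma> \<Zcomp> w = w" if "\<sigma> permutes {..<n}" for \<sigma>
  proof -
    have "perm_arrow C A n \<sigma> \<Zcomp> w = perm_arrow C A n id \<Zcomp> w"
      by (intro eq[rule_format] perm_arrow_in_diagram that permutes_id)
    then show ?thesis using w by (simp add: perm_arrow_id[OF A] Id_Comp)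
  qed
  then have "finprod (hom_monoid C P Z) (\<lambda>\<sigma>. perm_arrow C A n \<sigma> \<Zcomp> w) perms
      = finprod (hom_monoid C P Z) (\<lambda>_. w) perms"
    using w by (intro finprod_cong') auto
  then show ?thesis
    using symmetrizer_Comp[OF w] average_const[OF w] by simp
qed

lemma symmetrizer_absorb_right:
  assumes w: "w \<in> Hom C Z P"
    and eq: "\<forall>f\<in>perm_diagram C A n. \<forall>g\<in>perm_diagram C A n. w \<Zcomp> f = w \<Zcomp> g"
  shows "w \<Zcomp> symmetrizer C A n = w"
proof -
  have "Z \<in> Obj C" using w Dom_Obj by (auto simp: Hom_def)
  then interpret comm_monoid "hom_monoid C Z P" using A by (simp add: hom_comm_monoid)
  have "w \<Zcomp> perm_arrow C A n \<sigma> = w" if "\<sigma> permutes {..<n}" for \<sigma>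
  proof -
    have "w \<Zcomp> perm_arrow C A n \<sigma> = w \<Zcomp> perm_arrow C A n id"
      by (intro eq[rule_format] perm_arrow_in_diagram that permutes_id)
    then show ?thesis using w by (simp add: perm_arrow_id[OF A] Comp_Id)
  qed
  then have "finprod (hom_monoid C Z P) (\<lambda>\<sigma>. w \<Zcomp> perm_arrow C A n \<sigma>) perms
      = finprod (hom_monoid C Z P) (\<lambda>_. w) perms"
    using w by (intro finprod_cong') auto
  then show ?thesis
    using Comp_symmetrizer[OF w] average_const[OF w] by simp
qed

end
end

section \<open>Splittings and coequalizers\<close>

lemma is_coequalizer_Hom: "is_coequalizer C F P Q u \<Longrightarrow> Q \<in> Obj C \<and> u \<in> Hom C P Q"
  unfolding is_coequalizer_def by blast

text \<open>The properties of the symmetrizer on which the splitting argument rests. They are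
  symmetric under reversal of arrows, so each result also yields its dual.\<close>

locale absorbing_endomorphism = category C
  for C :: "('o, 'm, 'z) smc_data_scheme" (structure) +
  fixes F :: "'m set" and P :: 'o and e :: 'm
  assumes diagram_Hom: "F \<subseteq> Hom C P P"
    and e_Hom: "e \<in> Hom C P P"
    and diagram_Comp: "f \<in> F \<Longrightarrow> f \<Zcomp> e = e"
    and Comp_diagram: "f \<in> F \<Longrightarrow> e \<Zcomp> f = e"
    and absorb_left: "\<lbrakk>w \<in> Hom C P Z; \<forall>f\<in>F. \<forall>g\<in>F. f \<Zcomp> w = g \<Zcomp> w\<rbrakk> \<Longrightarrow> e \<Zcomp> w = w"
    and absorb_right: "\<lbrakk>w \<in> Hom C Z P; \<forall>f\<in>F. \<forall>g\<in>F. w \<Zcomp> f = w \<Zcomp> g\<rbrakk> \<Longrightarrow> w \<Zcomp> e = w"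
begin

lemma P_Obj: "P \<in> Obj C"
  using e_Hom Dom_Obj by (auto simp: Hom_def)

text \<open>By \<open>diagram_Comp\<close> the arrow \<open>e\<close> itself coequalizes the
  diagram, so the universal property applies to it.\<close>

lemma coequalizer_unique_section:
  assumes "is_coequalizer C F P Q u"
  shows "\<exists>!v. v \<in> Hom C Q P \<and> u \<Zcomp> v = e"
  using assms P_Obj e_Hom diagram_Comp unfolding is_coequalizer_def by metis

lemma coequalizer_section:
  assumes u: "is_coequalizer C F P Q u" and v: "v \<in> Hom C Q P" "u \<Zcomp> v = e"
  shows "v \<Zcomp> u = Id C Q"
proof -
  have Q: "Q \<in> Obj C" "u \<in> Hom C P Q" and eq: "\<forall>f\<in>F. \<forall>g\<in>F. f \<Zcomp> u = g \<Zcomp> u"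
    using u unfolding is_coequalizer_def by blast+
  \<comment> \<open>The universal property is applied to \<open>u\<close> itself: \<open>v\<close>
    followed by \<open>u\<close>, and the identity, are both factorizations of \<open>u\<close>
    through \<open>u\<close>.\<close>
  then have unique: "\<exists>!t. t \<in> Hom C Q Q \<and> u \<Zcomp> t = u"
    using u unfolding is_coequalizer_def by blast
  have "u \<Zcomp> (v \<Zcomp> u) = u"
    using absorb_left[OF Q(2) eq] Comp_assoc[OF Q(2) v(1) Q(2)] v(2) by simp
  moreover have "v \<Zcomp> u \<in> Hom C Q Q" "Id C Q \<in> Hom C Q Q" "u \<Zcomp> Id C Q = u"
    using Q v by (simp_all add: Comp_Hom Id_Hom Comp_Id)
  ultimately show ?thesis using unique by blast
qed

lemma splitting_coequalizer:
  assumes Q: "Q \<in> Obj C" and u: "u \<in> Hom C P Q" and v: "v \<in> Hom C Q P"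
    and uv: "u \<Zcomp> v = e" and vu: "v \<Zcomp> u = Id C Q"
  shows "is_coequalizer C F P Q u"
  unfolding is_coequalizer_def
proof (intro conjI Q u ballI impI)
  have "f \<Zcomp> u = u" if "f \<in> F" for f
  proof -
    have f: "f \<in> Hom C P P" using that diagram_Hom by blast
    have eu: "e \<Zcomp> u = u"
      using Comp_assoc[OF u v u] Comp_Id[OF u] by (simp only: uv vu)
    have "f \<Zcomp> u = f \<Zcomp> e \<Zcomp> u" by (simp only: Comp_assoc[OF f e_Hom u] eu)
    then show ?thesis by (simp only: diagram_Comp[OF that] eu)
  qed
  then show "f \<Zcomp> u = g \<Zcomp> u" if "f \<in> F" "g \<in> F" for f g
    using that by simp
next
  fix Z w
  assume w: "w \<in> Hom C P Z" and "\<forall>f\<in>F. \<forall>g\<in>F. f \<Zcomp> w = g \<Zcomp> w"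
  then have ew: "e \<Zcomp> w = w" by (rule absorb_left)
  show "\<exists>!t. t \<in> Hom C Q Z \<and> u \<Zcomp> t = w"
  proof
    show "v \<Zcomp> w \<in> Hom C Q Z \<and> u \<Zcomp> (v \<Zcomp> w) = w"
      using Comp_Hom[OF v w] Comp_assoc[OF u v w] ew by (simp add: uv)
    \<comment> \<open>Any such \<open>t\<close> equals v; u; t, which is v; w.\<close>
    show "t = v \<Zcomp> w" if "t \<in> Hom C Q Z \<and> u \<Zcomp> t = w" for t
      using that Comp_assoc[OF v u, of t Z] Id_Comp[of t Q Z] by (simp add: vu)
  qed
qed

end

text \<open>The tensor data are copied without being reversed, since the result serves only as a
  category.\<close>

definition opposite :: "('o, 'm, 'z) smc_data_scheme \<Rightarrow> ('o, 'm, 'z) smc_data_scheme" where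
  "opposite C = C\<lparr>Dom := Cod C, Cod := Dom C, Comp := \<lambda>f g. g \<Zcomp>\<^bsub>C\<^esub> f\<rparr>"

lemma opposite_simps [simp]:
  "Obj (opposite C) = Obj C" "Arr (opposite C) = Arr C" "Dom (opposite C) = Cod C"
  "Cod (opposite C) = Dom C" "Id (opposite C) = Id C" "f \<Zcomp>\<^bsub>opposite C\<^esub> g = g \<Zcomp>\<^bsub>C\<^esub> f"
  "Hom (opposite C) X Y = Hom C Y X"
  by (auto simp: opposite_def Hom_def)

lemma is_coequalizer_opposite: "is_coequalizer (opposite C) F P Q v \<longleftrightarrow> is_equalizer C F P Q v"
  by (simp add: is_coequalizer_def is_equalizer_def)

lemma (in absorbing_endomorphism) absorbing_endomorphism_opposite:
  "absorbing_endomorphism (opposite C) F P e"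
  using diagram_Hom e_Hom
  by unfold_locales
    (auto intro: Dom_Obj Cod_Obj Id_Hom Comp_Hom Id_Comp Comp_Id Comp_assoc[symmetric]
      diagram_Comp Comp_diagram absorb_left absorb_right)

lemma (in nonneg_rat_linear_smc) absorbing_endomorphism_symmetrizer:
  assumes "A \<in> Obj C"
  shows "absorbing_endomorphism C (perm_diagram C A n) (tensor_pow C A n) (symmetrizer C A n)"
proof unfold_locales
  show "perm_diagram C A n \<subseteq> Hom C (tensor_pow C A n) (tensor_pow C A n)"
    using perm_arrow_Hom[OF assms] by (auto simp: perm_diagram_def)
  show "symmetrizer C A n \<in> Hom C (tensor_pow C A n) (tensor_pow C A n)"
    by (rule symmetrizer_Hom[OF assms])
  show "f \<Zcomp> symmetrizer C A n = symmetrizer C A n" if "f \<in> perm_diagram C A n" for f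
    using that by (auto simp: perm_diagram_def perm_arrow_symmetrizer[OF assms])
  show "symmetrizer C A n \<Zcomp> f = symmetrizer C A n" if "f \<in> perm_diagram C A n" for f
    using that by (auto simp: perm_diagram_def symmetrizer_perm_arrow[OF assms])
qed (fact symmetrizer_absorb_left[OF assms] symmetrizer_absorb_right[OF assms])+

theorem proposition13:
  fixes C :: "('o, 'm, 'z) linear_smc_data_scheme" and A :: 'o and n :: nat
  assumes "nonneg_rat_linear_smc C" and "A \<in> Obj C"
  shows
    "(\<forall>(Q, u) \<in> sym_coequalizers C A n.
        \<exists>!v. v \<in> Hom C Q (tensor_pow C A n) \<and> u \<Zcomp>\<^bsub>C\<^esub> v = symmetrizer C A n) \<and>
     (\<forall>(Q, v) \<in> sym_equalizers C A n.
        \<exists>!u. u \<in> Hom C (tensor_pow C A n) Q \<and> u \<Zcomp>\<^bsub>C\<^esub> v = symmetrizer C A n) \<and>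
     bij_betw (coequalizer_to_splitting C A n) (sym_coequalizers C A n) (sym_splittings C A n) \<and>
     bij_betw splitting_to_coequalizer (sym_splittings C A n) (sym_coequalizers C A n) \<and>
     (\<forall>x \<in> sym_coequalizers C A n.
        splitting_to_coequalizer (coequalizer_to_splitting C A n x) = x) \<and>
     (\<forall>y \<in> sym_splittings C A n.
        coequalizer_to_splitting C A n (splitting_to_coequalizer y) = y) \<and>
     bij_betw splitting_to_equalizer (sym_splittings C A n) (sym_equalizers C A n) \<and>
     bij_betw (equalizer_to_splitting C A n) (sym_equalizers C A n) (sym_splittings C A n) \<and>
     (\<forall>y \<in> sym_splittings C A n.
        equalizer_to_splitting C A n (splitting_to_equalizer y) = y) \<and>
     (\<forall>z \<in> sym_equalizers C A n.
        splitting_to_equalizer (equalizer_to_splitting C A n z) = z)"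
proof -
  interpret nonneg_rat_linear_smc C by fact
  let ?P = "tensor_pow C A n" and ?e = "symmetrizer C A n"
  let ?coeq = "sym_coequalizers C A n" and ?split = "sym_splittings C A n"
    and ?eq = "sym_equalizers C A n"
  let ?ab = "coequalizer_to_splitting C A n" and ?cb = "equalizer_to_splitting C A n"
  interpret E: absorbing_endomorphism C "perm_diagram C A n" ?P ?e
    by (rule absorbing_endomorphism_symmetrizer) fact
  \<comment> \<open>In the opposite category \<open>v\<close> followed by \<open>u\<close> is u; v
    in \<open>C\<close>, so coequalizer facts in \<open>O\<close> become the equalizer facts in
    \<open>C\<close>.\<close>
  interpret O: absorbing_endomorphism "opposite C" "perm_diagram C A n" ?P ?e
    by (rule E.absorbing_endomorphism_opposite)
  have unique_v: "\<exists>!v. v \<in> Hom C Q ?P \<and> u \<Zcomp>\<^bsub>C\<^esub> v = ?e" if "(Q, u) \<in> ?coeq" for Q u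
    using that E.coequalizer_unique_section by (simp add: sym_coequalizers_def)
  have unique_u: "\<exists>!u. u \<in> Hom C ?P Q \<and> u \<Zcomp>\<^bsub>C\<^esub> v = ?e" if "(Q, v) \<in> ?eq" for Q v
    using that O.coequalizer_unique_section[of Q v]
    by (simp add: sym_equalizers_def is_coequalizer_opposite)
  have ab: "?ab ` ?coeq \<subseteq> ?split"
  proof (rule image_subsetI)
    fix x
    assume "x \<in> ?coeq"
    moreover obtain Q u where x: "x = (Q, u)" by (cases x)
    ultimately have u: "(Q, u) \<in> ?coeq" by simp
    then show "?ab x \<in> ?split"
      unfolding x
      using theI'[OF unique_v[OF u]] E.coequalizer_section[of Q u] is_coequalizer_Hom[of C _ _ Q u]
      by (auto simp: sym_coequalizers_def sym_splittings_def coequalizer_to_splitting_def)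
  qed
  have cb: "?cb ` ?eq \<subseteq> ?split"
  proof (rule image_subsetI)
    fix x
    assume "x \<in> ?eq"
    moreover obtain Q v where x: "x = (Q, v)" by (cases x)
    ultimately have v: "(Q, v) \<in> ?eq" by simp
    then show "?cb x \<in> ?split"
      unfolding x
      using theI'[OF unique_u[OF v]] O.coequalizer_section[of Q v]
        is_coequalizer_Hom[of "opposite C" _ _ Q v]
      by (auto simp: sym_equalizers_def sym_splittings_def equalizer_to_splitting_def
          is_coequalizer_opposite)
  qed
  have ba: "splitting_to_coequalizer ` ?split \<subseteq> ?coeq"
    using E.splitting_coequalizer
    by (auto simp: sym_coequalizers_def sym_splittings_def splitting_to_coequalizer_def)
  have bc: "splitting_to_equalizer ` ?split \<subseteq> ?eq"
    using O.splitting_coequalizer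
    by (auto simp: sym_equalizers_def sym_splittings_def splitting_to_equalizer_def
        is_coequalizer_opposite)
  \<comment> \<open>One map adds a component and the other forgets it, so unfolding
    suffices.\<close>
  have aba: "\<forall>x\<in>?coeq. splitting_to_coequalizer (?ab x) = x"
    by (auto simp: splitting_to_coequalizer_def coequalizer_to_splitting_def)
  have cbc: "\<forall>z\<in>?eq. splitting_to_equalizer (?cb z) = z"
    by (auto simp: splitting_to_equalizer_def equalizer_to_splitting_def)
  \<comment> \<open>The second arrow of a splitting satisfies the equation that defines the
    description, so uniqueness identifies it with the chosen one.\<close>
  have bab: "\<forall>y\<in>?split. ?ab (splitting_to_coequalizer y) = y"
  proof clarify
    fix Q u v
    assume y: "(Q, u, v) \<in> ?split"
    then have "(Q, u) \<in> ?coeq"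
      using ba by (force simp: splitting_to_coequalizer_def)
    then have "(THE v. v \<in> Hom C Q ?P \<and> u \<Zcomp>\<^bsub>C\<^esub> v = ?e) = v"
      using y by (intro the1_equality unique_v) (auto simp: sym_splittings_def)
    then show "?ab (splitting_to_coequalizer (Q, u, v)) = (Q, u, v)"
      by (simp add: splitting_to_coequalizer_def coequalizer_to_splitting_def)
  qed
  have bcb: "\<forall>y\<in>?split. ?cb (splitting_to_equalizer y) = y"
  proof clarify
    fix Q u v
    assume y: "(Q, u, v) \<in> ?split"
    then have "(Q, v) \<in> ?eq"
      using bc by (force simp: splitting_to_equalizer_def)
    then have "(THE u. u \<in> Hom C ?P Q \<and> u \<Zcomp>\<^bsub>C\<^esub> v = ?e) = u"
      using y by (intro the1_equality unique_u) (auto simp: sym_splittings_def)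
    then show "?cb (splitting_to_equalizer (Q, u, v)) = (Q, u, v)"
      by (simp add: splitting_to_equalizer_def equalizer_to_splitting_def)
  qed
  have "\<forall>(Q, u)\<in>?coeq. \<exists>!v. v \<in> Hom C Q ?P \<and> u \<Zcomp>\<^bsub>C\<^esub> v = ?e"
    "\<forall>(Q, v)\<in>?eq. \<exists>!u. u \<in> Hom C ?P Q \<and> u \<Zcomp>\<^bsub>C\<^esub> v = ?e"
    by (rule ballI, rule case_prodI2, rule unique_v unique_u, simp)+
  then show ?thesis
    by (intro conjI aba bab bcb cbc
        bij_betw_byWitness[OF aba bab ab ba] bij_betw_byWitness[OF bab aba ba ab]
        bij_betw_byWitness[OF bcb cbc bc cb] bij_betw_byWitness[OF cbc bcb cb bc])
qed

end
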